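(* Let $r\ge 2$ be an integer and let $\mathcal{H}$ be an $r$-uniform hypergraph on $n$ vertices such that $$P(\mathcal{H},k)-P_{DP}(\mathcal{H},k)=O(k^{n-r-1})\quad\text{as }k\to\infty .$$ Then there exist $p\in\mathbb{N}$ and $N\in\mathbb{N}$ such that $P_{DP}(K_p\vee\mathcal{H},k)=P(K_p\vee\mathcal{H},k)$ for all integers $k\ge N$.
   Context: $\mathbb{N}$ is the set of positive integers and $[k]=\{1,\dots,k\}$. A hypergraph $\mathcal{H}=(V,E)$ consists of a finite nonempty set $V$ and a set $E$ of subsets of $V$ with $|e|\ge 2$ for every $e\in E$ (simple: no repeated edges). It is $r$-uniform if $|e|=r$ for every $e\in E$. $K_p$ is the complete graph on $p$ vertices. The join $\mathcal{H}_1\vee\mathcal{H}_2$ of two vertex-disjoint hypergraphs is obtained from their union by adding all edges $\{u,v\}$ with $u$ a vertex of $\mathcal{H}_1$ and $v$ a vertex of $\mathcal{H}_2$. A proper $k$-coloring of $\mathcal{H}$ is a map $f:V\to[k]$ that is not constant on any edge; $P(\mathcal{H},k)$ is the number of proper $k$-colorings (the chromatic polynomial). A $k$-fold cover of $\mathcal{H}$ is a family $\mathcal{F}$ of partial maps $\varphi$ from $V$ to $[k]$, each having domain an edge of $\mathcal{H}$, such that if $\varphi\ne\psi$ in $\mathcal{F}$ have the same domain $e$, then $\varphi\cap\psi=\emptyset$ (as sets of pairs), i.e. $\varphi(v)\neq\psi(v)$ for all $v\in e$. An $\mathcal{F}$-coloring is a function $f:V\to[k]$ such that no $\varphi\in\mathcal{F}$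 satisfies $f|_{\mathrm{dom}(\varphi)}=\varphi$. $P_{DP}(\mathcal{H},\mathcal{F})$ is the number of $\mathcal{F}$-colorings of $\mathcal{H}$, and the DP color function $P_{DP}(\mathcal{H},k)$ is the minimum of $P_{DP}(\mathcal{H},\mathcal{F})$ over all $k$-fold covers $\mathcal{F}$ of $\mathcal{H}$. *)

theory Defs
  imports Complex_Main "HOL-Library.FuncSet" "HOL-Library.Landau_Symbols"
begin

record 'a hypergraph =
  verts :: "'a set"
  edges :: "'a set set"

definition hypergraph :: "'a hypergraph \<Rightarrow> bool" where
  "hypergraph H \<longleftrightarrow>
     finite (verts H) \<and> verts H \<noteq> {} \<and> (\<forall>e\<in>edges H. e \<subseteq> verts H \<and> card e \<ge> 2)"

definition uniform :: "nat \<Rightarrow> 'a hypergraph \<Rightarrow> bool" where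
  "uniform r H \<longleftrightarrow> (\<forall>e\<in>edges H. card e = r)"

definition complete_graph :: "nat \<Rightarrow> nat hypergraph" where
  "complete_graph p = \<lparr>verts = {1..p}, edges = {e. e \<subseteq> {1..p} \<and> card e = 2}\<rparr>"

(* The sum type makes the two vertex sets disjoint. *)
definition join :: "'a hypergraph \<Rightarrow> 'b hypergraph \<Rightarrow> ('a + 'b) hypergraph" where
  "join G H =
     \<lparr>verts = verts G <+> verts H,
      edges = (\<lambda>e. Inl ` e) ` edges G \<union> (\<lambda>e. Inr ` e) ` edges H
                \<union> {{Inl u, Inr v} | u v. u \<in> verts G \<and> v \<in> verts H}\<rparr>"

definition proper_colorings :: "'a hypergraph \<Rightarrow> nat \<Rightarrow> ('a \<Rightarrow> nat) set" where
  "proper_colorings H k =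
     {f \<in> verts H \<rightarrow>\<^sub>E {1..k}. \<forall>e\<in>edges H. \<not> (\<exists>c. \<forall>v\<in>e. f v = c)}"

definition chromatic_poly :: "'a hypergraph \<Rightarrow> nat \<Rightarrow> nat" where
  "chromatic_poly H k = card (proper_colorings H k)"

definition fold_cover :: "'a hypergraph \<Rightarrow> nat \<Rightarrow> ('a \<rightharpoonup> nat) set \<Rightarrow> bool" where
  "fold_cover H k F \<longleftrightarrow>
     (\<forall>\<phi>\<in>F. dom \<phi> \<in> edges H \<and> ran \<phi> \<subseteq> {1..k}) \<and>
     (\<forall>\<phi>\<in>F. \<forall>\<psi>\<in>F. \<phi> \<noteq> \<psi> \<and> dom \<phi> = dom \<psi> \<longrightarrow> Map.graph \<phi> \<inter> Map.graph \<psi> = {})"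

definition cover_colorings :: "'a hypergraph \<Rightarrow> nat \<Rightarrow> ('a \<rightharpoonup> nat) set \<Rightarrow> ('a \<Rightarrow> nat) set" where
  "cover_colorings H k F =
     {f \<in> verts H \<rightarrow>\<^sub>E {1..k}. \<not> (\<exists>\<phi>\<in>F. (Some \<circ> f) |` dom \<phi> = \<phi>)}"

definition DP_count :: "'a hypergraph \<Rightarrow> nat \<Rightarrow> ('a \<rightharpoonup> nat) set \<Rightarrow> nat" where
  "DP_count H k F = card (cover_colorings H k F)"

definition DP_color_fun :: "'a hypergraph \<Rightarrow> nat \<Rightarrow> nat" where
  "DP_color_fun H k = Min {DP_count H k F | F. fold_cover H k F}"

(* The minimum above ranges over a finite nonempty set. *)
lemma DP_counts_finite:
  assumes "hypergraph H"
  shows "finite {DP_count H k F | F. fold_cover H k F}"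
proof -
  have fin: "finite (verts H \<rightarrow>\<^sub>E {1..k})"
    using assms by (intro finite_PiE) (auto simp: hypergraph_def)
  have "{DP_count H k F | F. fold_cover H k F} \<subseteq> {..card (verts H \<rightarrow>\<^sub>E {1..k})}"
    using fin by (auto simp: DP_count_def cover_colorings_def intro!: card_mono)
  then show ?thesis
    by (rule finite_subset) simp
qed

lemma DP_counts_nonempty: "{DP_count H k F | F. fold_cover H k F} \<noteq> {}"
proof -
  have "fold_cover H k {}"
    by (simp add: fold_cover_def)
  then show ?thesis
    by blast
qed

lemma hypergraph_join:
  assumes "hypergraph G" "hypergraph H"
  shows "hypergraph (join G H)"
  using assms by (auto simp: hypergraph_def join_def card_image)

lemma hypergraph_complete_graph: "p \<ge> 1 \<Longrightarrow> hypergraph (complete_graph p)"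
  by (auto simp: hypergraph_def complete_graph_def)

end

theory Submission
  imports Defs
begin

text \<open>Add the vertices of \<open>K\<^sub>p\<close> one at a time and track the deficit \<open>D = P - P\<^sub>D\<^sub>P\<close>. In a cover of
  \<open>K\<^sub>1 \<or> G\<close> (a cone over \<open>G\<close>) each edge from the apex \<open>w\<close> to a vertex \<open>v\<close> carries a permutation \<open>\<sigma> v\<close>
  of the colors, so coloring \<open>w\<close> by \<open>c\<close> leaves \<open>v\<close> with the \<open>m = k - 1\<close> colors other than \<open>\<sigma> v c\<close>.
  If every map of the cover on an edge of \<open>G\<close> has the form \<open>v \<mapsto> \<sigma> v c\<close>, there are at least
  \<open>P(K\<^sub>1 \<or> G, k)\<close> colorings. Otherwise, for some \<open>c\<close>, an edge \<open>e\<close> keeps at most \<open>k - 2\<close> of its maps,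
  a further map can be added on \<open>e\<close>, and the colorings extending that map are surplus over
  \<open>P\<^sub>D\<^sub>P(G, m)\<close>. For edges forming an antichain there are about \<open>m\<close> to the power \<open>N - |e|\<close> of them,
  where \<open>N\<close> is the number of vertices of \<open>G\<close>. Hence a bound \<open>D(G, k) \<le> C * k ^ (N - r - 1)\<close>
  improves to the constant \<open>max 0 (C - 1/3)\<close> for \<open>K\<^sub>1 \<or> G\<close>, and after finitely many steps the constant
  is \<open>0\<close>. The bound is written as \<open>D * k ^ (r + 1) \<le> C * k ^ N\<close> because \<open>N - r - 1\<close> may be negative.\<close>

section \<open>Covers, colorings from lists, and the bound by the chromatic polynomial\<close>

text \<open>The contrapositive of the disjointness condition of \<open>fold_cover\<close>: one
  shared value identifies two maps on the same edge. This is the direction in which the counting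
  arguments apply it.\<close>

definition separated :: "('a \<rightharpoonup> nat) set \<Rightarrow> bool" where
  "separated F \<longleftrightarrow> (\<forall>\<phi>\<in>F. \<forall>\<psi>\<in>F. \<forall>v x. dom \<phi> = dom \<psi> \<and> \<phi> v = Some x \<and> \<psi> v = Some x \<longrightarrow> \<phi> = \<psi>)"

text \<open>Ranges are left unbounded because the color lists will vary from vertex to vertex. A map
  with a value outside the lists forbids nothing.\<close>

definition list_cover :: "'a hypergraph \<Rightarrow> ('a \<rightharpoonup> nat) set \<Rightarrow> bool" where
  "list_cover G F \<longleftrightarrow> (\<forall>\<phi>\<in>F. dom \<phi> \<in> edges G) \<and> separated F"

definition list_colorings :: "'a hypergraph \<Rightarrow> ('a \<Rightarrow> nat set) \<Rightarrow> ('a \<rightharpoonup> nat) set \<Rightarrow> ('a \<Rightarrow> nat) set" where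
  "list_colorings G L F =
     {f \<in> Pi\<^sub>E (verts G) L. \<forall>\<phi>\<in>F. \<exists>v x. \<phi> v = Some x \<and> f v \<noteq> x}"

text \<open>The join of a single vertex with \<open>G\<close>, kept on the vertex type of
  \<open>G\<close> so that the construction can be iterated; \<open>join\<close> would change the
  type at every step.\<close>

definition cone :: "'a \<Rightarrow> 'a hypergraph \<Rightarrow> 'a hypergraph" where
  "cone w G = \<lparr>verts = insert w (verts G), edges = edges G \<union> (\<lambda>v. {w, v}) ` verts G\<rparr>"

text \<open>Coning adds edges of size 2 and can destroy uniformity. Incomparability of edges
  survives and is what the count of colorings extending a given map requires.\<close>

definition antichain :: "'a hypergraph \<Rightarrow> bool" where
  "antichain G \<longleftrightarrow> (\<forall>e\<in>edges G. \<forall>e'\<in>edges G. e \<subseteq> e' \<longrightarrow> e = e')"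

lemma edge_subset: "hypergraph G \<Longrightarrow> e \<in> edges G \<Longrightarrow> e \<subseteq> verts G"
  by (simp add: hypergraph_def)

lemma edge_card: "hypergraph G \<Longrightarrow> e \<in> edges G \<Longrightarrow> card e \<ge> 2"
  by (simp add: hypergraph_def)

lemma separatedD:
  assumes "separated F" "\<phi> \<in> F" "\<psi> \<in> F" "dom \<phi> = dom \<psi>" "\<phi> v = Some x" "\<psi> v = Some x"
  shows "\<phi> = \<psi>"
  using assms(1)[unfolded separated_def, rule_format, of \<phi> \<psi> v x] assms(2-) by simp

lemma separated_subset: "separated F \<Longrightarrow> F' \<subseteq> F \<Longrightarrow> separated F'"
  unfolding separated_def by (meson subsetD)

lemma restrict_map_eq_iff: "(Some \<circ> f) |` dom \<phi> = \<phi> \<longleftrightarrow> (\<forall>v x. \<phi> v = Some x \<longrightarrow> f v = x)"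
proof
  assume *: "(Some \<circ> f) |` dom \<phi> = \<phi>"
  show "\<forall>v x. \<phi> v = Some x \<longrightarrow> f v = x"
  proof (intro allI impI)
    fix v x assume v: "\<phi> v = Some x"
    have "((Some \<circ> f) |` dom \<phi>) v = \<phi> v" using * by simp
    with v show "f v = x" by (auto simp: restrict_map_def dom_def)
  qed
next
  assume "\<forall>v x. \<phi> v = Some x \<longrightarrow> f v = x"
  then have "((Some \<circ> f) |` dom \<phi>) v = \<phi> v" for v
    by (cases "\<phi> v") (auto simp: restrict_map_def)
  then show "(Some \<circ> f) |` dom \<phi> = \<phi>" by blast
qed

lemma list_cover_dom:
  assumes "hypergraph G" "list_cover G F" "\<phi> \<in> F"
  shows "dom \<phi> \<subseteq> verts G"
  using assms by (meson hypergraph_def list_cover_def)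

lemma cover_colorings_eq: "cover_colorings G k F = list_colorings G (\<lambda>_. {1..k}) F"
  unfolding cover_colorings_def list_colorings_def restrict_map_eq_iff by auto

lemma fold_cover_iff:
  assumes "hypergraph G"
  shows "fold_cover G k F \<longleftrightarrow> list_cover G F \<and> (\<forall>\<phi>\<in>F. ran \<phi> \<subseteq> {1..k})"
  unfolding fold_cover_def list_cover_def separated_def Map.graph_def by blast

lemma finite_list_colorings:
  assumes "finite (verts G)" "\<And>v. v \<in> verts G \<Longrightarrow> finite (L v)"
  shows "finite (list_colorings G L F)"
  unfolding list_colorings_def using finite_PiE[of "verts G" L] assms by auto

lemma DP_color_fun_le:
  assumes "hypergraph G" "fold_cover G k F"
  shows "DP_color_fun G k \<le> card (list_colorings G (\<lambda>_. {1..k}) F)"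
  unfolding DP_color_fun_def
  by (rule Min_le[OF DP_counts_finite[OF assms(1)]])
     (use assms in \<open>auto simp: DP_count_def cover_colorings_eq\<close>)

lemma DP_color_fun_attained:
  assumes "hypergraph G"
  obtains F where "fold_cover G k F" "DP_color_fun G k = card (list_colorings G (\<lambda>_. {1..k}) F)"
proof -
  have "DP_color_fun G k \<in> {DP_count G k F | F. fold_cover G k F}"
    unfolding DP_color_fun_def by (rule Min_in[OF DP_counts_finite[OF assms] DP_counts_nonempty])
  then show ?thesis using that by (auto simp: DP_count_def cover_colorings_eq)
qed

text \<open>The constant maps on the edges form a cover, and every coloring for this cover is
  proper.\<close>

lemma DP_color_fun_le_chromatic_poly:
  assumes G: "hypergraph G"
  shows "DP_color_fun G k \<le> chromatic_poly G k"
proof -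
  define F where "F = {\<phi>. \<exists>e\<in>edges G. \<exists>c\<in>{1..k}. \<phi> = (\<lambda>v. if v \<in> e then Some c else None)}"
  have "fold_cover G k F"
    unfolding fold_cover_iff[OF G] list_cover_def separated_def F_def
    by (auto simp: dom_def ran_def split: if_splits)
  moreover have "list_colorings G (\<lambda>_. {1..k}) F \<subseteq> proper_colorings G k"
  proof
    fix f assume f: "f \<in> list_colorings G (\<lambda>_. {1..k}) F"
    have "\<not> (\<exists>c. \<forall>v\<in>e. f v = c)" if e: "e \<in> edges G" for e
    proof
      assume "\<exists>c. \<forall>v\<in>e. f v = c"
      then obtain c where c: "\<forall>v\<in>e. f v = c" by blast
      \<comment> \<open>A vertex of \<open>e\<close> shows that \<open>c\<close> is one of the
        \<open>k\<close> colors, so that the constant map with value \<open>c\<close> belongs to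
        \<open>F\<close>.\<close>
      have "e \<noteq> {}" "e \<subseteq> verts G" using G e by (auto simp: hypergraph_def)
      then obtain v where v: "v \<in> e" "v \<in> verts G" by blast
      have "c \<in> {1..k}" using f v c by (auto simp: list_colorings_def PiE_def Pi_def)
      then have "(\<lambda>v. if v \<in> e then Some c else None) \<in> F" using e unfolding F_def by blast
      with f c show False by (fastforce simp: list_colorings_def split: if_splits)
    qed
    with f show "f \<in> proper_colorings G k" by (auto simp: proper_colorings_def list_colorings_def)
  qed
  moreover have "finite (proper_colorings G k)"
    unfolding proper_colorings_def using G finite_PiE[of "verts G" "\<lambda>_. {1..k}"]
    by (auto simp: hypergraph_def)
  ultimately show ?thesis
    unfolding chromatic_poly_def using DP_color_fun_le[OF G] card_mono order_trans by blast
qed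

text \<open>Renaming colors by a bijection preserves being non-constant on an edge. The color set
  left by a colored apex, \<open>{1..Suc m} - {c}\<close>, is the intended \<open>S\<close>.\<close>

lemma card_monochromatic_free_le:
  assumes G: "hypergraph G" and S: "finite S"
  shows "card {f \<in> verts G \<rightarrow>\<^sub>E S. \<forall>e\<in>edges G. \<not> (\<exists>c. \<forall>v\<in>e. f v = c)} \<le> chromatic_poly G (card S)"
proof -
  obtain b where b: "bij_betw b S {1..card S}"
    using S by (metis finite_same_card_bij finite_atLeastAtMost card_atLeastAtMost add_diff_cancel_right' Suc_eq_plus1)
  let ?A = "{f \<in> verts G \<rightarrow>\<^sub>E S. \<forall>e\<in>edges G. \<not> (\<exists>c. \<forall>v\<in>e. f v = c)}"
  let ?h = "\<lambda>f. restrict (b \<circ> f) (verts G)"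
  have inj: "inj_on b S" and im: "\<And>x. x \<in> S \<Longrightarrow> b x \<in> {1..card S}"
    using b by (auto simp: bij_betw_def)
  have "inj_on ?h ?A"
  proof (rule inj_onI)
    fix f g assume f: "f \<in> ?A" and g: "g \<in> ?A" and eq: "?h f = ?h g"
    show "f = g"
    proof (rule PiE_ext)
      show "f \<in> verts G \<rightarrow>\<^sub>E S" "g \<in> verts G \<rightarrow>\<^sub>E S" using f g by auto
      fix v assume v: "v \<in> verts G"
      have "b (f v) = b (g v)" using fun_cong[OF eq, of v] v by simp
      then show "f v = g v" using inj f g v by (auto simp: inj_on_def PiE_def Pi_def)
    qed
  qed
  moreover have "?h ` ?A \<subseteq> proper_colorings G (card S)"
  proof clarify
    fix f assume f: "f \<in> verts G \<rightarrow>\<^sub>E S" and p: "\<forall>e\<in>edges G. \<not> (\<exists>c. \<forall>v\<in>e. f v = c)"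
    have "\<not> (\<exists>c. \<forall>v\<in>e. ?h f v = c)" if e: "e \<in> edges G" for e
    proof
      assume "\<exists>c. \<forall>v\<in>e. ?h f v = c"
      then obtain c where c: "\<forall>v\<in>e. ?h f v = c" by blast
      have sub: "e \<noteq> {}" "e \<subseteq> verts G" using G e by (auto simp: hypergraph_def)
      then obtain v where v: "v \<in> e" by blast
      have "f u = f v" if u: "u \<in> e" for u
      proof -
        have "b (f u) = b (f v)" using c u v sub by (metis (no_types, lifting) comp_apply restrict_apply' subsetD)
        moreover have "f u \<in> S" "f v \<in> S" using f u v sub by auto
        ultimately show ?thesis using inj by (auto simp: inj_on_def)
      qed
      with p e show False by blast
    qed
    moreover have "?h f \<in> verts G \<rightarrow>\<^sub>E {1..card S}"
      using PiE_mem[OF f] im by (simp add: PiE_iff)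
    ultimately show "?h f \<in> proper_colorings G (card S)"
      unfolding proper_colorings_def by blast
  qed
  moreover have "finite (proper_colorings G (card S))"
    unfolding proper_colorings_def using G finite_PiE[of "verts G" "\<lambda>_. {1..card S}"]
    by (auto simp: hypergraph_def)
  ultimately show ?thesis unfolding chromatic_poly_def by (rule card_inj_on_le)
qed

section \<open>Lists of equal size and the surplus from a missing map\<close>

text \<open>Covers are insensitive to renaming colors separately at each vertex. Identifying every
  list with \<open>{1..m}\<close> turns \<open>F\<close> into an \<open>m\<close>-fold cover without
  producing new colorings.\<close>

lemma DP_color_fun_le_list_colorings:
  assumes G: "hypergraph G" and F: "list_cover G F"
    and L: "\<And>v. v \<in> verts G \<Longrightarrow> finite (L v) \<and> card (L v) = m"
  shows "DP_color_fun G m \<le> card (list_colorings G L F)"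
proof -
  have "\<exists>b. bij_betw b {1..m} (L v)" if "v \<in> verts G" for v
    using L[OF that] by (intro finite_same_card_bij) auto
  then obtain b where b: "\<And>v. v \<in> verts G \<Longrightarrow> bij_betw (b v) {1..m} (L v)" by metis
  \<comment> \<open>The preimage of \<open>F\<close> under the renaming. Maps of \<open>F\<close>
    that leave the lists have no preimage, and the bound on the range makes the renaming injective
    on \<open>F'\<close>.\<close>
  define F' where "F' = {\<phi>'. ran \<phi>' \<subseteq> {1..m} \<and> (\<lambda>v. map_option (b v) (\<phi>' v)) \<in> F}"
  have dom: "dom (\<lambda>v. map_option (b v) (\<phi> v)) = dom \<phi>" for \<phi> by (auto simp: dom_def)
  have "fold_cover G m F'"
    unfolding fold_cover_iff[OF G] list_cover_def
  proof (intro conjI ballI)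
    show "dom \<phi> \<in> edges G" if "\<phi> \<in> F'" for \<phi>
      using that F dom unfolding F'_def list_cover_def by (metis (no_types, lifting) mem_Collect_eq)
    show "ran \<phi> \<subseteq> {1..m}" if "\<phi> \<in> F'" for \<phi>
      using that unfolding F'_def by blast
    show "separated F'"
      unfolding separated_def
    proof (intro ballI allI impI)
      fix \<phi> \<psi> v x
      assume *: "\<phi> \<in> F'" "\<psi> \<in> F'" "dom \<phi> = dom \<psi> \<and> \<phi> v = Some x \<and> \<psi> v = Some x"
      let ?\<phi> = "\<lambda>v. map_option (b v) (\<phi> v)" and ?\<psi> = "\<lambda>v. map_option (b v) (\<psi> v)"
      have "?\<phi> \<in> F" "?\<psi> \<in> F" "dom ?\<phi> = dom ?\<psi>" "?\<phi> v = Some (b v x)" "?\<psi> v = Some (b v x)"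
        using * dom unfolding F'_def by auto
      then have eq: "?\<phi> = ?\<psi>" using F unfolding list_cover_def separated_def by blast
      have sub: "dom \<phi> \<subseteq> verts G"
        using list_cover_dom[OF G F \<open>?\<phi> \<in> F\<close>] dom by simp
      show "\<phi> = \<psi>"
      proof
        fix u
        show "\<phi> u = \<psi> u"
        proof (cases "\<phi> u")
          case None
          then show ?thesis using * by (metis domIff)
        next
          case (Some y)
          then obtain z where z: "\<psi> u = Some z" using * by (metis domD domI)
          have "b u y = b u z" using fun_cong[OF eq, of u] Some z by simp
          moreover have "u \<in> verts G" using Some sub by blast
          moreover have "y \<in> {1..m}" "z \<in> {1..m}" using Some z * unfolding F'_def by (auto intro: ranI)
          ultimately have "y = z" using b by (meson bij_betw_imp_inj_on inj_onD)
          then show ?thesis using Some z by simp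
        qed
      qed
    qed
  qed
  then have "DP_color_fun G m \<le> card (list_colorings G (\<lambda>_. {1..m}) F')"
    by (rule DP_color_fun_le[OF G])
  also have "\<dots> \<le> card (list_colorings G L F)"
  proof (rule card_inj_on_le)
    let ?h = "\<lambda>f. restrict (\<lambda>v. b v (f v)) (verts G)"
    show "inj_on ?h (list_colorings G (\<lambda>_. {1..m}) F')"
    proof (rule inj_onI)
      fix f g assume f: "f \<in> list_colorings G (\<lambda>_. {1..m}) F'"
        and g: "g \<in> list_colorings G (\<lambda>_. {1..m}) F'" and eq: "?h f = ?h g"
      show "f = g"
      proof (rule PiE_ext)
        show fg: "f \<in> verts G \<rightarrow>\<^sub>E {1..m}" "g \<in> verts G \<rightarrow>\<^sub>E {1..m}"
          using f g by (auto simp: list_colorings_def)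
        fix v assume v: "v \<in> verts G"
        have "b v (f v) = b v (g v)" using fun_cong[OF eq, of v] v by simp
        moreover have "f v \<in> {1..m}" "g v \<in> {1..m}" using fg v by blast+
        ultimately show "f v = g v" using b[OF v] by (meson bij_betw_imp_inj_on inj_onD)
      qed
    qed
    show "?h ` list_colorings G (\<lambda>_. {1..m}) F' \<subseteq> list_colorings G L F"
    proof clarify
      fix f assume f: "f \<in> list_colorings G (\<lambda>_. {1..m}) F'"
      have fr: "f v \<in> {1..m}" if "v \<in> verts G" for v
        using f that unfolding list_colorings_def by blast
      have "\<exists>v x. \<phi> v = Some x \<and> ?h f v \<noteq> x" if \<phi>: "\<phi> \<in> F" for \<phi>
      proof (rule ccontr)
        assume "\<not> ?thesis"
        then have a: "\<And>v x. \<phi> v = Some x \<Longrightarrow> ?h f v = x" by blast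
        have sub: "dom \<phi> \<subseteq> verts G" using \<phi> list_cover_dom[OF G F] by blast
        \<comment> \<open>If the renamed coloring extended \<open>\<phi>\<close>, then
          \<open>f\<close> would extend the preimage of \<open>\<phi>\<close>, which lies in
          \<open>F'\<close>.\<close>
        define \<phi>' where "\<phi>' = (\<lambda>v. if v \<in> dom \<phi> then Some (f v) else None)"
        have "(\<lambda>v. map_option (b v) (\<phi>' v)) = \<phi>"
        proof
          fix v show "map_option (b v) (\<phi>' v) = \<phi> v"
            using a[of v] sub unfolding \<phi>'_def by (cases "\<phi> v") auto
        qed
        moreover have "ran \<phi>' \<subseteq> {1..m}" using fr sub unfolding \<phi>'_def ran_def by (auto split: if_splits)
        ultimately have "\<phi>' \<in> F'" using \<phi> unfolding F'_def by simp
        then obtain v x where "\<phi>' v = Some x" "f v \<noteq> x" using f unfolding list_colorings_def by blast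
        then show False unfolding \<phi>'_def by (simp split: if_splits)
      qed
      moreover have "?h f \<in> Pi\<^sub>E (verts G) L"
        using fr bij_betwE[OF b] by (simp add: PiE_iff)
      ultimately show "?h f \<in> list_colorings G L F" unfolding list_colorings_def by blast
    qed
    show "finite (list_colorings G L F)"
      by (rule finite_list_colorings) (use G L in \<open>auto simp: hypergraph_def\<close>)
  qed
  finally show ?thesis .
qed


text \<open>On an edge other than \<open>e\<close>, a coloring extending \<open>\<psi>\<close> that meets a forbidden map is determined
  outside \<open>e\<close> and one further vertex, because by separation one value of the forbidden map
  fixes all the others.\<close>

lemma card_extending_colorings:
  assumes G: "hypergraph G" and anti: "antichain G" and F: "list_cover G F"
    and L: "\<And>v. v \<in> verts G \<Longrightarrow> finite (L v) \<and> card (L v) = m"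
    and e: "e \<in> edges G" and dom\<psi>: "dom \<psi> = e"
    and \<psi>L: "\<And>v x. \<psi> v = Some x \<Longrightarrow> x \<in> L v"
    and free: "\<And>\<phi> v x. \<phi> \<in> F \<Longrightarrow> dom \<phi> = e \<Longrightarrow> \<phi> v = Some x \<Longrightarrow> \<psi> v \<noteq> Some x"
  shows "m ^ (card (verts G) + 1) \<le>
     card {f \<in> list_colorings G L F. \<forall>v x. \<psi> v = Some x \<longrightarrow> f v = x} * m ^ (card e + 1)
       + card (edges G) * m ^ card (verts G)"
proof -
  let ?V = "verts G"
  let ?X = "{f \<in> list_colorings G L F. \<forall>v x. \<psi> v = Some x \<longrightarrow> f v = x}"
  \<comment> \<open>\<open>A\<close> ignores the cover and so has exactly m to the power |V - e|
    elements. The wanted colorings are those in \<open>A\<close> that avoid every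
    \<open>Bad e'\<close> with \<open>e'\<close> other than \<open>e\<close>; maps of
    \<open>F\<close> on \<open>e\<close> itself disagree with \<open>\<psi>\<close>
    everywhere.\<close>
  define A where "A = {f \<in> Pi\<^sub>E ?V L. \<forall>v x. \<psi> v = Some x \<longrightarrow> f v = x}"
  define Bad where "Bad e' = {f \<in> A. \<exists>\<phi>\<in>F. dom \<phi> = e' \<and> (\<forall>v x. \<phi> v = Some x \<longrightarrow> f v = x)}" for e'
  have finV: "finite ?V" using G by (simp add: hypergraph_def)
  have edge: "e' \<subseteq> ?V" "card e' \<ge> 2" if "e' \<in> edges G" for e'
    using G that by (auto simp: hypergraph_def)
  have eV: "e \<subseteq> ?V" and fine: "finite e" using edge[OF e] finV finite_subset by auto
  have finE: "finite (edges G)" using edge(1) finV by (meson Pow_iff finite_Pow_iff finite_subset subsetI)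
  have finPi: "finite (Pi\<^sub>E ?V L)" using finV L by (intro finite_PiE) auto
  then have finA: "finite A" unfolding A_def by simp
  have "A = Pi\<^sub>E ?V (\<lambda>v. if v \<in> e then {the (\<psi> v)} else L v)"
  proof (intro equalityI subsetI)
    fix f assume f: "f \<in> A"
    have "f v = the (\<psi> v)" if "v \<in> e" for v
      using f that dom\<psi> unfolding A_def by auto
    with f show "f \<in> Pi\<^sub>E ?V (\<lambda>v. if v \<in> e then {the (\<psi> v)} else L v)"
      unfolding A_def by (simp add: PiE_iff)
  next
    fix f assume f: "f \<in> Pi\<^sub>E ?V (\<lambda>v. if v \<in> e then {the (\<psi> v)} else L v)"
    have ext: "f v = x" if "\<psi> v = Some x" for v x
    proof -
      have "v \<in> e" using that dom\<psi> by blast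
      then show ?thesis using PiE_mem[OF f, of v] eV that by auto
    qed
    have "f v \<in> L v" if v: "v \<in> ?V" for v
    proof (cases "v \<in> e")
      case True
      then obtain x where "\<psi> v = Some x" using dom\<psi> by blast
      then show ?thesis using ext \<psi>L by metis
    next
      case False
      then show ?thesis using PiE_mem[OF f v] by simp
    qed
    with f ext show "f \<in> A" unfolding A_def by (simp add: PiE_iff)
  qed
  then have "card A = (\<Prod>v\<in>?V. if v \<in> e then 1 else m)"
    using finV L by (simp add: card_PiE if_distrib cong: if_cong)
  also have "\<dots> = m ^ card (?V - e)"
    using finV by (simp add: prod.If_cases Diff_eq)
  finally have cardA: "card A = m ^ card (?V - e)" .
  have Vmin: "card (?V - e) + card e = card ?V"
    using eV finV by (metis card_Diff_subset card_mono fine le_add_diff_inverse2)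
  \<comment> \<open>The factor \<open>m ^ (card e + 1)\<close> replaces an exponent formed by
    subtraction with \<open>card ?V\<close>.\<close>
  have bad: "card (Bad e') * m ^ (card e + 1) \<le> m ^ card ?V" if e': "e' \<in> edges G - {e}" for e'
  proof -
    \<comment> \<open>The antichain condition gives \<open>u\<close> outside \<open>e\<close>, whose
      color is to be recovered. The second vertex \<open>v\<close> may lie inside or outside
      \<open>e\<close>; its color selects the forbidden map, which then dictates the color of
      \<open>u\<close>.\<close>
    have "\<not> e' \<subseteq> e" using anti e e' unfolding antichain_def by blast
    then obtain u where u: "u \<in> e'" "u \<notin> e" by blast
    have "e' \<noteq> {u}" using edge(2)[of e'] e' by auto
    then obtain v where v: "v \<in> e'" "v \<noteq> u" using u by blast
    have uV: "u \<in> ?V" using u edge(1) e' by blast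
    have vV: "v \<in> ?V" using v edge(1) e' by blast
    let ?W = "?V - e - {u}"
    have "card (Bad e') \<le> card (Pi\<^sub>E ?W L)"
    proof (rule card_inj_on_le)
      show "inj_on (\<lambda>f. restrict f ?W) (Bad e')"
      proof (rule inj_onI)
        fix f g assume f: "f \<in> Bad e'" and g: "g \<in> Bad e'" and eq: "restrict f ?W = restrict g ?W"
        have fg: "f \<in> Pi\<^sub>E ?V L" "g \<in> Pi\<^sub>E ?V L" using f g unfolding Bad_def A_def by auto
        have on_e: "f x = g x" if x: "x \<in> e" for x
        proof -
          obtain y where "\<psi> x = Some y" using x dom\<psi> by blast
          then show ?thesis using f g unfolding Bad_def A_def by auto
        qed
        have off: "f x = g x" if "x \<in> ?V" "x \<noteq> u" for x
          using on_e fun_cong[OF eq, of x] that by (cases "x \<in> e") auto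
        obtain \<phi> where \<phi>: "\<phi> \<in> F" "dom \<phi> = e'" "\<And>v x. \<phi> v = Some x \<Longrightarrow> f v = x"
          using f unfolding Bad_def by blast
        obtain \<phi>' where \<phi>': "\<phi>' \<in> F" "dom \<phi>' = e'" "\<And>v x. \<phi>' v = Some x \<Longrightarrow> g v = x"
          using g unfolding Bad_def by blast
        have "\<phi> v = Some (f v)" "\<phi>' v = Some (g v)" using \<phi> \<phi>' v by blast+
        then have "\<phi> = \<phi>'"
          using F \<phi> \<phi>' off[OF vV v(2)] unfolding list_cover_def separated_def by metis
        then have "f u = g u" using \<phi> \<phi>' u by (metis domD)
        then show "f = g" using off fg by (metis PiE_ext)
      qed
      show "(\<lambda>f. restrict f ?W) ` Bad e' \<subseteq> Pi\<^sub>E ?W L"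
        unfolding Bad_def A_def by (simp add: image_subset_iff PiE_iff)
      show "finite (Pi\<^sub>E ?W L)" using finV L by (intro finite_PiE) auto
    qed
    also have "\<dots> = m ^ card ?W" using finV L by (simp add: card_PiE)
    finally have "card (Bad e') * m ^ (card e + 1) \<le> m ^ card ?W * m ^ (card e + 1)"
      by (rule mult_right_mono) simp
    also have "\<dots> = m ^ (card ?W + (card e + 1))" by (simp only: power_add)
    also have "card ?W + (card e + 1) = card ?V"
    proof -
      have "card (?V - e) = Suc (card ?W)"
        using u uV finV by (intro card.remove) auto
      then show ?thesis using Vmin by simp
    qed
    finally show ?thesis .
  qed
  have sub: "A \<subseteq> ?X \<union> (\<Union>e'\<in>edges G - {e}. Bad e')"
  proof
    fix f assume f: "f \<in> A"
    show "f \<in> ?X \<union> (\<Union>e'\<in>edges G - {e}. Bad e')"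
    proof (rule ccontr)
      assume not: "f \<notin> ?X \<union> (\<Union>e'\<in>edges G - {e}. Bad e')"
      then have "f \<notin> list_colorings G L F" using f unfolding A_def by blast
      then obtain \<phi> where \<phi>: "\<phi> \<in> F" "\<And>v x. \<phi> v = Some x \<Longrightarrow> f v = x"
        using f unfolding A_def list_colorings_def by blast
      have d: "dom \<phi> \<in> edges G" using F \<phi> unfolding list_cover_def by blast
      have "f \<in> Bad (dom \<phi>)" using f \<phi> unfolding Bad_def by blast
      with not d have de: "dom \<phi> = e" by blast
      obtain v where "v \<in> e" using edge(2)[OF e] by fastforce
      then obtain x y where "\<phi> v = Some x" "\<psi> v = Some y" using de dom\<psi> by blast
      moreover from this have "x = y" using \<phi>(2)[of v x] f unfolding A_def by auto
      ultimately show False using free[OF \<phi>(1) de] by blast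
    qed
  qed
  have finX: "finite ?X" using finPi unfolding list_colorings_def by simp
  have "card A \<le> card (?X \<union> (\<Union>e'\<in>edges G - {e}. Bad e'))"
    using finX finE finA by (intro card_mono[OF _ sub]) (auto simp: Bad_def)
  also have "\<dots> \<le> card ?X + card (\<Union>e'\<in>edges G - {e}. Bad e')" by (rule card_Un_le)
  also have "card (\<Union>e'\<in>edges G - {e}. Bad e') \<le> (\<Sum>e'\<in>edges G - {e}. card (Bad e'))"
    using finE by (intro card_UN_le) auto
  finally have "card A * m ^ (card e + 1)
      \<le> (card ?X + (\<Sum>e'\<in>edges G - {e}. card (Bad e'))) * m ^ (card e + 1)"
    by (intro mult_right_mono) auto
  also have "\<dots> = card ?X * m ^ (card e + 1) + (\<Sum>e'\<in>edges G - {e}. card (Bad e') * m ^ (card e + 1))"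
    by (simp only: distrib_right sum_distrib_right)
  also have "(\<Sum>e'\<in>edges G - {e}. card (Bad e') * m ^ (card e + 1)) \<le> (\<Sum>e'\<in>edges G - {e}. m ^ card ?V)"
    by (intro sum_mono bad)
  also have "\<dots> \<le> card (edges G) * m ^ card ?V"
    using card_Diff1_le[of "edges G" e] by (simp add: mult_right_mono del: card_Diff_insert)
  finally have "card A * m ^ (card e + 1) \<le> card ?X * m ^ (card e + 1) + card (edges G) * m ^ card ?V"
    by simp
  moreover have "card A * m ^ (card e + 1) = m ^ (card ?V + 1)"
    unfolding cardA Vmin[symmetric] by (simp only: power_add[symmetric] add.assoc)
  ultimately show ?thesis by (simp only:)
qed

text \<open>With fewer than \<open>m\<close> maps on \<open>e\<close> inside the lists, each vertex
  of \<open>e\<close> has a color that none of them takes, and these colors make up a map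
  \<open>\<psi>\<close> that can join the cover. The enlarged cover still has at least
  \<open>DP_color_fun G m\<close> colorings; \<open>X\<close> counts those lost by adding
  \<open>\<psi>\<close>.\<close>

lemma DP_color_fun_gain:
  assumes G: "hypergraph G" and anti: "antichain G" and F: "list_cover G F"
    and L: "\<And>v. v \<in> verts G \<Longrightarrow> finite (L v) \<and> card (L v) = m"
    and e: "e \<in> edges G"
    and few: "finite {\<phi> \<in> F. dom \<phi> = e \<and> (\<forall>v x. \<phi> v = Some x \<longrightarrow> x \<in> L v)}"
      "card {\<phi> \<in> F. dom \<phi> = e \<and> (\<forall>v x. \<phi> v = Some x \<longrightarrow> x \<in> L v)} < m"
  obtains X where "DP_color_fun G m + X \<le> card (list_colorings G L F)"
    "m ^ (card (verts G) + 1) \<le> X * m ^ (card e + 1) + card (edges G) * m ^ card (verts G)"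
proof -
  \<comment> \<open>Dropping the maps that leave the lists changes no coloring and makes room for
    \<open>\<psi>\<close>: only the maps counted in \<open>few\<close> still compete with it on
    \<open>e\<close>.\<close>
  define F1 where "F1 = {\<phi> \<in> F. \<forall>v x. \<phi> v = Some x \<longrightarrow> x \<in> L v}"
  let ?Fe = "{\<phi> \<in> F. dom \<phi> = e \<and> (\<forall>v x. \<phi> v = Some x \<longrightarrow> x \<in> L v)}"
  have F1: "list_cover G F1" using F unfolding F1_def list_cover_def separated_def by blast
  have same: "list_colorings G L F1 = list_colorings G L F"
  proof (intro equalityI subsetI)
    fix f assume f: "f \<in> list_colorings G L F1"
    have "\<exists>v x. \<phi> v = Some x \<and> f v \<noteq> x" if \<phi>: "\<phi> \<in> F" for \<phi>
    proof (cases "\<phi> \<in> F1")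
      case True
      then show ?thesis using f unfolding list_colorings_def by blast
    next
      case False
      then obtain v x where vx: "\<phi> v = Some x" "x \<notin> L v" using \<phi> unfolding F1_def by blast
      then have "v \<in> verts G" using list_cover_dom[OF G F \<phi>] by blast
      then have "f v \<in> L v" using f unfolding list_colorings_def by blast
      with vx show ?thesis by blast
    qed
    with f show "f \<in> list_colorings G L F" unfolding list_colorings_def by blast
  qed (auto simp: list_colorings_def F1_def)
  \<comment> \<open>The colors can be chosen independently at each vertex, because separation only
    asks that \<open>\<psi>\<close> differ from every other map on \<open>e\<close> at each
    vertex.\<close>
  have "\<forall>v\<in>e. \<exists>x. x \<in> L v \<and> x \<notin> (\<lambda>\<phi>. the (\<phi> v)) ` ?Fe"
  proof
    fix v assume "v \<in> e"
    then have "v \<in> verts G" using G e unfolding hypergraph_def by blast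
    moreover have "card ((\<lambda>\<phi>. the (\<phi> v)) ` ?Fe) < m"
      using card_image_le[OF few(1), of "\<lambda>\<phi>. the (\<phi> v)"] few(2) by linarith
    ultimately have "\<not> L v \<subseteq> (\<lambda>\<phi>. the (\<phi> v)) ` ?Fe"
      using L few(1) card_mono[of "(\<lambda>\<phi>. the (\<phi> v)) ` ?Fe" "L v"] by force
    then show "\<exists>x. x \<in> L v \<and> x \<notin> (\<lambda>\<phi>. the (\<phi> v)) ` ?Fe" by blast
  qed
  from bchoice[OF this] obtain c where c: "\<forall>v\<in>e. c v \<in> L v \<and> c v \<notin> (\<lambda>\<phi>. the (\<phi> v)) ` ?Fe"
    by blast
  define \<psi> where "\<psi> = (\<lambda>v. if v \<in> e then Some (c v) else None)"
  have dom\<psi>: "dom \<psi> = e" unfolding \<psi>_def by (auto split: if_splits)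
  have \<psi>L: "x \<in> L v" if "\<psi> v = Some x" for v x
    using that bspec[OF c, of v] unfolding \<psi>_def by (simp split: if_splits)
  have free: "\<psi> v \<noteq> Some x" if "\<phi> \<in> F1" "dom \<phi> = e" "\<phi> v = Some x" for \<phi> v x
  proof
    assume "\<psi> v = Some x"
    then have v: "v \<in> e" "c v = x" unfolding \<psi>_def by (auto split: if_splits)
    have "\<phi> \<in> ?Fe" using that unfolding F1_def by blast
    then have "the (\<phi> v) \<in> (\<lambda>\<phi>. the (\<phi> v)) ` ?Fe" by blast
    then show False using bspec[OF c v(1)] v(2) that(3) by simp
  qed
  have F2: "list_cover G (insert \<psi> F1)"
    unfolding list_cover_def
  proof
    show "\<forall>\<phi>\<in>insert \<psi> F1. dom \<phi> \<in> edges G" using F1 e dom\<psi> unfolding list_cover_def by blast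
    show "separated (insert \<psi> F1)"
      unfolding separated_def
    proof (intro ballI allI impI)
      fix \<phi> \<phi>' v x
      assume *: "\<phi> \<in> insert \<psi> F1" "\<phi>' \<in> insert \<psi> F1"
        "dom \<phi> = dom \<phi>' \<and> \<phi> v = Some x \<and> \<phi>' v = Some x"
      show "\<phi> = \<phi>'"
      proof (cases "\<phi> = \<psi> \<or> \<phi>' = \<psi>")
        case True
        then show ?thesis using * free[of \<phi> v x] free[of \<phi>' v x] dom\<psi> by auto
      next
        case False
        then show ?thesis using * F1 unfolding list_cover_def separated_def by blast
      qed
    qed
  qed
  let ?X = "{f \<in> list_colorings G L F1. \<forall>v x. \<psi> v = Some x \<longrightarrow> f v = x}"
  have "list_colorings G L (insert \<psi> F1)
      = {f \<in> list_colorings G L F1. \<not> (\<forall>v x. \<psi> v = Some x \<longrightarrow> f v = x)}"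
    unfolding list_colorings_def by auto
  then have split: "list_colorings G L (insert \<psi> F1) \<union> ?X = list_colorings G L F1"
    "list_colorings G L (insert \<psi> F1) \<inter> ?X = {}"
    by auto
  have fin: "finite (list_colorings G L F1)"
    by (rule finite_list_colorings) (use G L in \<open>auto simp: hypergraph_def\<close>)
  then have "card (list_colorings G L F1) = card (list_colorings G L (insert \<psi> F1)) + card ?X"
  proof -
    have "finite (list_colorings G L (insert \<psi> F1) \<union> ?X)"
      unfolding split(1) by (rule fin)
    then have "finite (list_colorings G L (insert \<psi> F1))" "finite ?X"
      unfolding finite_Un by blast+
    from card_Un_disjoint[OF this split(2)] show ?thesis unfolding split(1) .
  qed
  moreover have "DP_color_fun G m \<le> card (list_colorings G L (insert \<psi> F1))"
    by (rule DP_color_fun_le_list_colorings[OF G F2 L])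
  ultimately have "DP_color_fun G m + card ?X \<le> card (list_colorings G L F)"
    using same by simp
  moreover have "m ^ (card (verts G) + 1) \<le> card ?X * m ^ (card e + 1) + card (edges G) * m ^ card (verts G)"
    by (rule card_extending_colorings[OF G anti F1 _ e dom\<psi>]) (use L \<psi>L free in blast)+
  ultimately show ?thesis by (rule that)
qed

section \<open>Cones: edges, permutations from a cover, proper colorings\<close>

lemma hypergraph_cone:
  assumes "hypergraph G" "w \<notin> verts G"
  shows "hypergraph (cone w G)"
proof -
  have "card {w, v} = 2" if "v \<in> verts G" for v using that assms(2) by (auto simp: card_2_iff)
  with assms show ?thesis by (auto simp: hypergraph_def cone_def)
qed

text \<open>An edge of \<open>G\<close> misses \<open>w\<close>, so it contains no apex edge; having
  two vertices in \<open>G\<close>, it fits inside none either.\<close>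

lemma antichain_cone:
  assumes G: "hypergraph G" "w \<notin> verts G" and anti: "antichain G"
  shows "antichain (cone w G)"
proof -
  have 1: "\<not> e \<subseteq> {w, v}" "\<not> {w, v} \<subseteq> e" if e: "e \<in> edges G" for e v
  proof -
    have sub: "e \<subseteq> verts G" "card e \<ge> 2" using G(1) e by (auto simp: hypergraph_def)
    then show "\<not> {w, v} \<subseteq> e" using G(2) by blast
    show "\<not> e \<subseteq> {w, v}"
    proof
      assume "e \<subseteq> {w, v}"
      then have "e \<subseteq> {v}" using sub G(2) by blast
      then have "card e \<le> card {v}" by (intro card_mono) auto
      then show False using sub by simp
    qed
  qed
  have 2: "{w, v} = {w, u}" if "{w, v} \<subseteq> {w, u}" "v \<in> verts G" for u v
    using that G(2) by blast
  show ?thesis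
    unfolding antichain_def cone_def hypergraph.simps
  proof (intro ballI impI)
    fix e e' assume "e \<in> edges G \<union> (\<lambda>v. {w, v}) ` verts G" "e' \<in> edges G \<union> (\<lambda>v. {w, v}) ` verts G" "e \<subseteq> e'"
    then show "e = e'" using 1 2 anti unfolding antichain_def by blast
  qed
qed

text \<open>\<open>A\<close> and its image have complements of equal size in \<open>S\<close>, and
  any bijection between these completes \<open>g\<close>.\<close>

lemma extend_injection:
  assumes S: "finite S" and A: "A \<subseteq> S" and g: "inj_on g A" "g ` A \<subseteq> S"
  shows "\<exists>\<sigma>. bij_betw \<sigma> S S \<and> (\<forall>x\<in>A. \<sigma> x = g x)"
proof -
  have fA: "finite A" using S A finite_subset by blast
  have "card (S - A) = card (S - g ` A)"
    using S A g fA by (simp add: card_Diff_subset card_image)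
  then obtain h where h: "bij_betw h (S - A) (S - g ` A)"
    using S finite_same_card_bij[of "S - A" "S - g ` A"] by blast
  let ?\<sigma> = "\<lambda>x. if x \<in> A then g x else h x"
  have "bij_betw ?\<sigma> A (g ` A)"
    using g(1) by (subst bij_betw_cong[of _ _ g]) (auto simp: bij_betw_def)
  moreover have "bij_betw ?\<sigma> (S - A) (S - g ` A)"
    using h by (subst bij_betw_cong[of _ _ h]) auto
  ultimately have "bij_betw ?\<sigma> (A \<union> (S - A)) (g ` A \<union> (S - g ` A))"
    by (rule bij_betw_combine) blast
  moreover have "A \<union> (S - A) = S" "g ` A \<union> (S - g ` A) = S" using A g by blast+
  ultimately show ?thesis by (intro exI[of _ ?\<sigma>]) simp
qed

text \<open>By separation, applied at \<open>w\<close> and at \<open>v\<close>, the maps on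
  \<open>{w, v}\<close> form a partial matching of colors, which extends to a permutation. Avoiding
  the whole permutation therefore avoids every map of the cover on this edge.\<close>

lemma cone_cover_permutation:
  assumes G: "hypergraph G" "w \<notin> verts G" and F: "fold_cover (cone w G) k F" and v: "v \<in> verts G"
  shows "\<exists>\<sigma>. bij_betw \<sigma> {1..k} {1..k} \<and>
    (\<forall>\<phi>\<in>F. dom \<phi> = {w, v} \<longrightarrow> (\<forall>x y. \<phi> w = Some x \<and> \<phi> v = Some y \<longrightarrow> y = \<sigma> x))"
proof -
  have sep: "separated F" and ran: "\<And>\<phi>. \<phi> \<in> F \<Longrightarrow> ran \<phi> \<subseteq> {1..k}"
    using F unfolding fold_cover_iff[OF hypergraph_cone[OF G]] list_cover_def by blast+
  have uniq: "\<phi> = \<psi>" if "\<phi> \<in> F" "\<psi> \<in> F" "dom \<phi> = {w, v}" "dom \<psi> = {w, v}" "\<phi> u = Some x" "\<psi> u = Some x"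
    for \<phi> \<psi> u x
    by (rule separatedD[OF sep that(1,2) _ that(5,6)]) (simp only: that)
  define R where "R x y \<longleftrightarrow> (\<exists>\<phi>\<in>F. dom \<phi> = {w, v} \<and> \<phi> w = Some x \<and> \<phi> v = Some y)" for x y
  define A where "A = {x. \<exists>y. R x y}"
  define g where "g x = (THE y. R x y)" for x
  have func: "y = z" if "R x y" "R x z" for x y z
  proof -
    from that obtain \<phi> \<psi> where *: "\<phi> \<in> F" "dom \<phi> = {w, v}" "\<phi> w = Some x" "\<phi> v = Some y"
      "\<psi> \<in> F" "dom \<psi> = {w, v}" "\<psi> w = Some x" "\<psi> v = Some z" unfolding R_def by blast
    then have "\<phi> = \<psi>" using uniq[of \<phi> \<psi> w x] by simp
    with * show ?thesis by simp
  qed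
  have inj: "x = z" if "R x y" "R z y" for x y z
  proof -
    from that obtain \<phi> \<psi> where *: "\<phi> \<in> F" "dom \<phi> = {w, v}" "\<phi> w = Some x" "\<phi> v = Some y"
      "\<psi> \<in> F" "dom \<psi> = {w, v}" "\<psi> w = Some z" "\<psi> v = Some y" unfolding R_def by blast
    then have "\<phi> = \<psi>" using uniq[of \<phi> \<psi> v y] by simp
    with * show ?thesis by simp
  qed
  have g: "g x = y" if "R x y" for x y
    unfolding g_def using that func by blast
  have Rk: "x \<in> {1..k} \<and> y \<in> {1..k}" if "R x y" for x y
    using that ran unfolding R_def by (meson ranI subsetD)
  have "\<exists>\<sigma>. bij_betw \<sigma> {1..k} {1..k} \<and> (\<forall>x\<in>A. \<sigma> x = g x)"
  proof (rule extend_injection)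
    show "A \<subseteq> {1..k}" using Rk unfolding A_def by blast
    show "inj_on g A"
    proof (rule inj_onI)
      fix x x' assume "x \<in> A" "x' \<in> A" and eq: "g x = g x'"
      then obtain y y' where R: "R x y" "R x' y'" unfolding A_def by blast
      with eq have "y = y'" using g by simp
      with R show "x = x'" using inj by simp
    qed
    show "g ` A \<subseteq> {1..k}"
    proof (rule image_subsetI)
      fix x assume "x \<in> A"
      then obtain y where "R x y" unfolding A_def by blast
      then show "g x \<in> {1..k}" using g Rk by simp
    qed
  qed simp
  then obtain \<sigma> where \<sigma>: "bij_betw \<sigma> {1..k} {1..k}" "\<forall>x\<in>A. \<sigma> x = g x" by blast
  have "y = \<sigma> x" if R: "R x y" for x y
  proof -
    have "x \<in> A" using R unfolding A_def by blast
    then show ?thesis using \<sigma>(2) g[OF R] by simp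
  qed
  then have "\<forall>\<phi>\<in>F. dom \<phi> = {w, v} \<longrightarrow> (\<forall>x y. \<phi> w = Some x \<and> \<phi> v = Some y \<longrightarrow> y = \<sigma> x)"
    unfolding R_def by blast
  then show ?thesis using \<sigma>(1) by (intro exI[of _ \<sigma>] conjI)
qed

text \<open>Each of the \<open>Suc m\<close> colors of the apex is excluded at all other vertices,
  which leaves a coloring of \<open>G\<close> with \<open>m\<close> colors.\<close>

lemma chromatic_poly_cone_le:
  assumes G: "hypergraph G" "w \<notin> verts G"
  shows "chromatic_poly (cone w G) (Suc m) \<le> Suc m * chromatic_poly G m"
proof -
  let ?T = "\<lambda>c. {f \<in> verts G \<rightarrow>\<^sub>E ({1..Suc m} - {c}). \<forall>e\<in>edges G. \<not> (\<exists>c. \<forall>v\<in>e. f v = c)}"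
  have finV: "finite (verts G)" using G by (simp add: hypergraph_def)
  have finT: "finite (?T c)" for c
    using finite_PiE[OF finV, of "\<lambda>_. {1..Suc m} - {c}"] by simp
  have "chromatic_poly (cone w G) (Suc m) \<le> card (Sigma {1..Suc m} ?T)"
    unfolding chromatic_poly_def
  proof (rule card_inj_on_le)
    let ?h = "\<lambda>f. (f w, restrict f (verts G))"
    show "inj_on ?h (proper_colorings (cone w G) (Suc m))"
    proof (rule inj_onI)
      fix f g assume f: "f \<in> proper_colorings (cone w G) (Suc m)" and g: "g \<in> proper_colorings (cone w G) (Suc m)"
        and eq: "?h f = ?h g"
      have "f v = g v" if "v \<in> insert w (verts G)" for v
        using that eq by (metis insert_iff prod.inject restrict_apply')
      moreover have "f \<in> insert w (verts G) \<rightarrow>\<^sub>E {1..Suc m}" "g \<in> insert w (verts G) \<rightarrow>\<^sub>E {1..Suc m}"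
        using f g unfolding proper_colorings_def cone_def by auto
      ultimately show "f = g" by (metis PiE_ext)
    qed
    show "?h ` proper_colorings (cone w G) (Suc m) \<subseteq> Sigma {1..Suc m} ?T"
    proof (rule image_subsetI)
      fix f assume "f \<in> proper_colorings (cone w G) (Suc m)"
      then have f: "f \<in> insert w (verts G) \<rightarrow>\<^sub>E {1..Suc m}"
        and p: "\<And>e. e \<in> edges G \<Longrightarrow> \<not> (\<exists>c. \<forall>v\<in>e. f v = c)"
        and pw: "\<And>v. v \<in> verts G \<Longrightarrow> \<not> (\<exists>c. \<forall>u\<in>{w, v}. f u = c)"
        unfolding proper_colorings_def cone_def hypergraph.simps by blast+
      have "restrict f (verts G) \<in> verts G \<rightarrow>\<^sub>E ({1..Suc m} - {f w})"
        using PiE_mem[OF f] pw by (auto simp: PiE_iff)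
      moreover have "\<not> (\<exists>c. \<forall>v\<in>e. restrict f (verts G) v = c)" if e: "e \<in> edges G" for e
      proof -
        have "e \<subseteq> verts G" using G(1) e by (auto simp: hypergraph_def)
        then show ?thesis using p[OF e] by (metis restrict_apply' subsetD)
      qed
      moreover have "f w \<in> {1..Suc m}" using PiE_mem[OF f] by blast
      ultimately show "?h f \<in> Sigma {1..Suc m} ?T" by blast
    qed
    show "finite (Sigma {1..Suc m} ?T)" using finT by blast
  qed
  also have "\<dots> = (\<Sum>c\<in>{1..Suc m}. card (?T c))" using finT by simp
  also have "\<dots> \<le> (\<Sum>c\<in>{1..Suc m}. chromatic_poly G m)"
  proof (rule sum_mono)
    fix c assume "c \<in> {1..Suc m}"
    then show "card (?T c) \<le> chromatic_poly G m"
      using card_monochromatic_free_le[OF G(1), of "{1..Suc m} - {c}"] by simp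
  qed
  finally show ?thesis by simp
qed

section \<open>How the deficit changes under a cone\<close>

text \<open>Both alternatives come from one cover attaining the minimum. If its maps on edges of
  \<open>G\<close> all follow the permutations, renaming colors embeds the proper colorings.
  Otherwise one color of the apex produces the surplus \<open>X\<close>.\<close>

lemma DP_color_fun_cone:
  assumes G: "hypergraph G" "w \<notin> verts G" and anti: "antichain G"
    and r: "\<And>e. e \<in> edges G \<Longrightarrow> card e \<le> r" and m: "m \<ge> 1"
  shows "chromatic_poly (cone w G) (Suc m) \<le> DP_color_fun (cone w G) (Suc m) \<or>
    (\<exists>X. Suc m * DP_color_fun G m + X \<le> DP_color_fun (cone w G) (Suc m) \<and>
       m ^ (card (verts G) + 1) \<le> X * m ^ (r + 1) + card (edges G) * m ^ card (verts G))"
proof -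
  let ?k = "Suc m" and ?C = "cone w G" and ?V = "verts G"
  have C: "hypergraph ?C" by (rule hypergraph_cone[OF G])
  have finV: "finite ?V" using G by (simp add: hypergraph_def)
  have VC: "verts ?C = insert w ?V" and EC: "edges ?C = edges G \<union> (\<lambda>v. {w, v}) ` ?V"
    by (simp_all add: cone_def)
  obtain F where F: "fold_cover ?C ?k F"
    and DP: "DP_color_fun ?C ?k = card (list_colorings ?C (\<lambda>_. {1..?k}) F)"
    using DP_color_fun_attained[OF C] by blast
  have sep: "separated F" and ran: "\<And>\<phi>. \<phi> \<in> F \<Longrightarrow> ran \<phi> \<subseteq> {1..?k}"
    and domE: "\<And>\<phi>. \<phi> \<in> F \<Longrightarrow> dom \<phi> \<in> edges ?C"
    using F unfolding fold_cover_iff[OF C] list_cover_def by blast+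
  have "\<forall>v\<in>?V. \<exists>\<sigma>. bij_betw \<sigma> {1..?k} {1..?k} \<and>
    (\<forall>\<phi>\<in>F. dom \<phi> = {w, v} \<longrightarrow> (\<forall>x y. \<phi> w = Some x \<and> \<phi> v = Some y \<longrightarrow> y = \<sigma> x))"
    using cone_cover_permutation[OF G F] by blast
  from bchoice[OF this] obtain \<sigma> where \<sigma>0: "\<forall>v\<in>?V. bij_betw (\<sigma> v) {1..?k} {1..?k} \<and>
    (\<forall>\<phi>\<in>F. dom \<phi> = {w, v} \<longrightarrow> (\<forall>x y. \<phi> w = Some x \<and> \<phi> v = Some y \<longrightarrow> y = \<sigma> v x))" ..
  have bij: "bij_betw (\<sigma> v) {1..?k} {1..?k}" if "v \<in> ?V" for v
    using \<sigma>0 that by simp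
  have \<sigma>: "y = \<sigma> v x" if "\<phi> \<in> F" "v \<in> ?V" "dom \<phi> = {w, v}" "\<phi> w = Some x" "\<phi> v = Some y" for \<phi> v x y
    using \<sigma>0 that by simp
  have finC: "finite (list_colorings ?C (\<lambda>_. {1..?k}) F)"
    by (rule finite_list_colorings) (use finV VC in auto)
  show ?thesis
  proof (cases "\<forall>\<phi>\<in>F. dom \<phi> \<in> edges G \<longrightarrow> (\<exists>c\<in>{1..?k}. \<forall>v\<in>dom \<phi>. \<phi> v = Some (\<sigma> v c))")
    case True
    \<comment> \<open>With the identity at the apex, the maps on apex edges acquire the same form as
      those on edges of \<open>G\<close>: color \<open>x\<close> at \<open>w\<close> is paired with
      \<open>\<sigma> v x\<close> at \<open>v\<close>.\<close>
    define \<tau> where "\<tau> v = (if v = w then id else \<sigma> v)" for v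
    have \<tau>bij: "bij_betw (\<tau> v) {1..?k} {1..?k}" if "v \<in> insert w ?V" for v
      using bij that unfolding \<tau>_def by auto
    have can: "\<exists>c\<in>{1..?k}. \<forall>v\<in>dom \<phi>. \<phi> v = Some (\<tau> v c)" if \<phi>: "\<phi> \<in> F" for \<phi>
    proof (cases "dom \<phi> \<in> edges G")
      case d: True
      have "w \<notin> dom \<phi>" using edge_subset[OF G(1) d] G(2) by (rule contra_subsetD)
      then have "\<tau> v = \<sigma> v" if "v \<in> dom \<phi>" for v using that unfolding \<tau>_def by auto
      moreover obtain c where "c \<in> {1..?k}" "\<forall>v\<in>dom \<phi>. \<phi> v = Some (\<sigma> v c)"
        using True \<phi> d by blast
      ultimately show ?thesis by (intro bexI[of _ c]) simp_all
    next
      case False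
      then obtain v where v: "v \<in> ?V" "dom \<phi> = {w, v}" using domE[OF \<phi>] EC by auto
      then obtain x y where xy: "\<phi> w = Some x" "\<phi> v = Some y" by blast
      have "x \<in> {1..?k}" using ran[OF \<phi>] xy by (meson ranI subsetD)
      moreover have "v \<noteq> w" using v G(2) by blast
      ultimately show ?thesis using \<sigma>[OF \<phi> v xy] xy v unfolding \<tau>_def by auto
    qed
    have "chromatic_poly ?C ?k \<le> card (list_colorings ?C (\<lambda>_. {1..?k}) F)"
      unfolding chromatic_poly_def
    proof (rule card_inj_on_le)
      let ?h = "\<lambda>f. restrict (\<lambda>v. \<tau> v (f v)) (verts ?C)"
      have inj\<tau>: "x = y" if "\<tau> v x = \<tau> v y" "v \<in> verts ?C" "x \<in> {1..?k}" "y \<in> {1..?k}" for v x y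
        using \<tau>bij that VC by (metis bij_betw_imp_inj_on inj_onD)
      show "inj_on ?h (proper_colorings ?C ?k)"
      proof (rule inj_onI)
        fix f g assume "f \<in> proper_colorings ?C ?k" "g \<in> proper_colorings ?C ?k" and eq: "?h f = ?h g"
        then have fg: "f \<in> verts ?C \<rightarrow>\<^sub>E {1..?k}" "g \<in> verts ?C \<rightarrow>\<^sub>E {1..?k}"
          unfolding proper_colorings_def by simp_all
        have "f v = g v" if v: "v \<in> verts ?C" for v
          using fun_cong[OF eq, of v] v by (intro inj\<tau>[OF _ v PiE_mem[OF fg(1) v] PiE_mem[OF fg(2) v]]) simp
        then show "f = g" by (rule PiE_ext[OF fg])
      qed
      show "?h ` proper_colorings ?C ?k \<subseteq> list_colorings ?C (\<lambda>_. {1..?k}) F"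
      proof (rule image_subsetI)
        fix f assume "f \<in> proper_colorings ?C ?k"
        then have f: "f \<in> verts ?C \<rightarrow>\<^sub>E {1..?k}"
          and p: "\<And>e. e \<in> edges ?C \<Longrightarrow> \<not> (\<exists>c. \<forall>v\<in>e. f v = c)"
          unfolding proper_colorings_def by blast+
        have "\<exists>v x. \<phi> v = Some x \<and> ?h f v \<noteq> x" if \<phi>: "\<phi> \<in> F" for \<phi>
        proof (rule ccontr)
          assume not: "\<not> ?thesis"
          obtain c where c: "c \<in> {1..?k}" "\<And>v. v \<in> dom \<phi> \<Longrightarrow> \<phi> v = Some (\<tau> v c)"
            using can[OF \<phi>] by blast
          have "f v = c" if v: "v \<in> dom \<phi>" for v
          proof -
            have vC: "v \<in> verts ?C" using edge_subset[OF C domE[OF \<phi>]] v by (rule subsetD)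
            have "?h f v = \<tau> v c" using not c(2)[OF v] by blast
            then have "\<tau> v (f v) = \<tau> v c" using vC by simp
            then show ?thesis using inj\<tau>[OF _ vC PiE_mem[OF f vC] c(1)] by blast
          qed
          then show False using p[OF domE[OF \<phi>]] by blast
        qed
        moreover have "?h f \<in> verts ?C \<rightarrow>\<^sub>E {1..?k}"
          using PiE_mem[OF f] bij_betwE[OF \<tau>bij] VC by (simp add: PiE_iff)
        ultimately show "?h f \<in> list_colorings ?C (\<lambda>_. {1..?k}) F"
          unfolding list_colorings_def by blast
      qed
    qed (rule finC)
    then show ?thesis using DP by simp
  next
    case False
    then obtain \<phi>0 where \<phi>0: "\<phi>0 \<in> F" "dom \<phi>0 \<in> edges G"
      and non: "\<And>c. c \<in> {1..?k} \<Longrightarrow> \<exists>v\<in>dom \<phi>0. \<phi>0 v \<noteq> Some (\<sigma> v c)" by blast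
    define e where "e = dom \<phi>0"
    have e: "e \<in> edges G" using \<phi>0 e_def by simp
    have eV: "e \<subseteq> ?V" "card e \<ge> 2" using edge_subset[OF G(1) e] edge_card[OF G(1) e] .
    have "e \<noteq> {}" using eV(2) by auto
    \<comment> \<open>The apex color \<open>c\<close> is chosen to agree with \<open>\<phi>0\<close>
      at \<open>v0\<close>, so that \<open>\<phi>0\<close> leaves the lists for \<open>c\<close>.
      Since \<open>\<phi>0\<close> does not follow the permutations at \<open>c\<close>, there is
      also a vertex \<open>u\<close> where the two differ.\<close>
    then obtain v0 where v0: "v0 \<in> e" by blast
    then obtain y where y: "\<phi>0 v0 = Some y" unfolding e_def by blast
    have "y \<in> {1..?k}" using ran[OF \<phi>0(1)] y by (meson ranI subsetD)
    moreover have "\<sigma> v0 ` {1..?k} = {1..?k}" using bij v0 eV by (meson bij_betw_imp_surj_on subsetD)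
    ultimately obtain c where c: "c \<in> {1..?k}" "y = \<sigma> v0 c" by blast
    obtain u where u: "u \<in> e" "\<phi>0 u \<noteq> Some (\<sigma> u c)" using non[OF c(1)] unfolding e_def by blast
    then obtain z where z: "\<phi>0 u = Some z" unfolding e_def by blast
    have zk: "z \<in> {1..?k}" using ran[OF \<phi>0(1)] z by (meson ranI subsetD)
    have \<sigma>k: "\<sigma> v d \<in> {1..?k}" if "v \<in> ?V" "d \<in> {1..?k}" for v d
      using bij that by (meson bij_betwE)
    define FG where "FG = {\<phi> \<in> F. dom \<phi> \<in> edges G}"
    define L where "L d v = {1..?k} - {\<sigma> v d}" for d v
    have FG: "list_cover G FG"
      using separated_subset[OF sep, of FG] unfolding list_cover_def FG_def by blast
    have L: "finite (L d v) \<and> card (L d v) = m" if "d \<in> {1..?k}" "v \<in> ?V" for d v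
      using \<sigma>k[OF that(2,1)] unfolding L_def by simp
    let ?T = "\<lambda>d. list_colorings G (L d) FG"
    have finT: "finite (?T d)" for d
      by (rule finite_list_colorings) (auto simp: finV L_def)
    let ?Fe = "{\<phi> \<in> FG. dom \<phi> = e \<and> (\<forall>v x. \<phi> v = Some x \<longrightarrow> x \<in> L c v)}"
    \<comment> \<open>At \<open>u\<close>, a surviving map on \<open>e\<close> takes neither the
      removed color \<open>\<sigma> u c\<close> nor the value \<open>z\<close> of
      \<open>\<phi>0\<close>, by separation. These two colors differ, so at most
      \<open>k - 2 = m - 1\<close> maps survive.\<close>
    let ?B = "{1..?k} - {\<sigma> u c, z}"
    have inj: "inj_on (\<lambda>\<phi>. the (\<phi> u)) ?Fe"
    proof (rule inj_onI)
      fix \<phi> \<psi> assume *: "\<phi> \<in> ?Fe" "\<psi> \<in> ?Fe" "the (\<phi> u) = the (\<psi> u)"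
      then obtain a b where "\<phi> u = Some a" "\<psi> u = Some b" using u(1) by blast
      then show "\<phi> = \<psi>" using separatedD[OF sep, of \<phi> \<psi> u a] * unfolding FG_def by simp
    qed
    have im: "(\<lambda>\<phi>. the (\<phi> u)) ` ?Fe \<subseteq> ?B"
    proof (rule image_subsetI)
      fix \<phi> assume "\<phi> \<in> ?Fe"
      then have \<phi>: "\<phi> \<in> FG" "dom \<phi> = e" "\<forall>v x. \<phi> v = Some x \<longrightarrow> x \<in> L c v" by simp_all
      then obtain a where a: "\<phi> u = Some a" using u(1) by blast
      have "\<phi> \<noteq> \<phi>0" using \<phi>(3) y c unfolding L_def by blast
      moreover have "\<phi> = \<phi>0" if "a = z"
        using separatedD[OF sep, of \<phi> \<phi>0 u z] \<phi> \<phi>0 a z that unfolding FG_def e_def by simp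
      moreover have "a \<in> L c u" using \<phi>(3) a by blast
      ultimately show "the (\<phi> u) \<in> ?B" using a unfolding L_def by auto
    qed
    have finB: "finite ?B" by simp
    have "card ?B = ?k - 2"
      using u z zk \<sigma>k[of u c] eV c by (subst card_Diff_subset) auto
    then have few: "card ?Fe < m" using card_inj_on_le[OF inj im finB] m by simp
    have finFe: "finite ?Fe" using inj_on_finite[OF inj im finB] .
    obtain X where X: "DP_color_fun G m + X \<le> card (?T c)"
      "m ^ (card ?V + 1) \<le> X * m ^ (card e + 1) + card (edges G) * m ^ card ?V"
      by (rule DP_color_fun_gain[OF G(1) anti FG _ e finFe few]) (use L[OF c(1)] in blast)+
    have le: "DP_color_fun G m \<le> card (?T d)" if "d \<in> {1..?k}" for d
      by (rule DP_color_fun_le_list_colorings[OF G(1) FG L[OF that]])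
    \<comment> \<open>Every apex color contributes at least \<open>DP_color_fun G m\<close>
      colorings; the surplus is credited to \<open>c\<close> alone.\<close>
    have "Suc m * DP_color_fun G m + X = (\<Sum>d\<in>{1..?k}. DP_color_fun G m + (if d = c then X else 0))"
      using c(1) by (simp add: sum.distrib)
    also have "\<dots> \<le> (\<Sum>d\<in>{1..?k}. card (?T d))"
      using X(1) le by (intro sum_mono) simp
    also have "\<dots> = card (Sigma {1..?k} ?T)" using finT by simp
    also have "\<dots> \<le> card (list_colorings ?C (\<lambda>_. {1..?k}) F)"
    proof (rule card_inj_on_le)
      let ?h = "\<lambda>(d, g). g(w := d)"
      \<comment> \<open>Colorings of \<open>G\<close> are \<open>undefined\<close> at
        \<open>w\<close>, so overwriting that value loses no information.\<close>
      have out: "g w = undefined" if "g \<in> ?T d" for g d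
        using that G(2) unfolding list_colorings_def by (auto simp: PiE_iff extensional_def)
      show "inj_on ?h (Sigma {1..?k} ?T)"
      proof (rule inj_onI, clarify)
        fix d g d' g' assume g: "g \<in> ?T d" "g' \<in> ?T d'" and eq: "g(w := d) = g'(w := d')"
        have "g = g'"
        proof
          fix v show "g v = g' v" using fun_cong[OF eq, of v] out[OF g(1)] out[OF g(2)] by (cases "v = w") auto
        qed
        then show "d = d' \<and> g = g'" using fun_cong[OF eq, of w] by simp
      qed
      show "?h ` Sigma {1..?k} ?T \<subseteq> list_colorings ?C (\<lambda>_. {1..?k}) F"
      proof clarify
        fix d g assume d: "d \<in> {1..?k}" and g: "g \<in> ?T d"
        have gL: "g \<in> Pi\<^sub>E ?V (L d)" using g unfolding list_colorings_def by blast
        have "\<exists>v x. \<phi> v = Some x \<and> (g(w := d)) v \<noteq> x" if \<phi>: "\<phi> \<in> F" for \<phi>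
        proof (cases "dom \<phi> \<in> edges G")
          case True
          have "w \<notin> dom \<phi>" using edge_subset[OF G(1) True] G(2) by (rule contra_subsetD)
          moreover obtain v x where "\<phi> v = Some x" "g v \<noteq> x"
            using g \<phi> True unfolding list_colorings_def FG_def by blast
          ultimately show ?thesis by (metis domI fun_upd_apply)
        next
          case False
          then obtain v where v: "v \<in> ?V" "dom \<phi> = {w, v}" using domE[OF \<phi>] EC by auto
          then obtain a b where ab: "\<phi> w = Some a" "\<phi> v = Some b" by blast
          have "b = \<sigma> v a" by (rule \<sigma>[OF \<phi> v ab])
          moreover have "v \<noteq> w" using v G(2) by blast
          moreover have "g v \<noteq> \<sigma> v d" using PiE_mem[OF gL v(1)] unfolding L_def by blast
          ultimately show ?thesis using ab by (metis fun_upd_apply)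
        qed
        moreover have "g(w := d) \<in> insert w ?V \<rightarrow>\<^sub>E {1..?k}"
          using gL d by (auto simp: PiE_iff L_def extensional_def)
        ultimately show "g(w := d) \<in> list_colorings ?C (\<lambda>_. {1..?k}) F"
          unfolding list_colorings_def VC by blast
      qed
    qed (rule finC)
    finally have "Suc m * DP_color_fun G m + X \<le> DP_color_fun ?C ?k" using DP by simp
    \<comment> \<open>Smaller edges only increase the guaranteed surplus, so the estimate can be
      weakened to the uniform exponent \<open>r + 1\<close>.\<close>
    moreover have "X * m ^ (card e + 1) \<le> X * m ^ (r + 1)"
      using r[OF e] m by (intro mult_left_mono power_increasing) auto
    then have "m ^ (card ?V + 1) \<le> X * m ^ (r + 1) + card (edges G) * m ^ card ?V"
      using X(2) by linarith
    ultimately show ?thesis by blast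
  qed
qed

text \<open>The new deficit is at most \<open>Suc m\<close> times the old one minus
  \<open>X\<close>. Relative to the new normalization the first term contributes about
  \<open>C\<close>, and the surplus removes at least about 1/2 once \<open>m\<close> is large.
  Stating 1/3 leaves room for the limit; the maximum with 0 covers a nonpositive deficit.\<close>

lemma cone_deficit:
  fixes C :: real
  assumes G: "hypergraph G" "w \<notin> verts G" and anti: "antichain G"
    and r: "\<And>e. e \<in> edges G \<Longrightarrow> card e \<le> r"
    and ev: "\<forall>\<^sub>F k in sequentially.
      (real (chromatic_poly G k) - real (DP_color_fun G k)) * real k ^ (r + 1) \<le> C * real k ^ card (verts G)"
  shows "\<forall>\<^sub>F k in sequentially.
    (real (chromatic_poly (cone w G) k) - real (DP_color_fun (cone w G) k)) * real k ^ (r + 1)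
      \<le> max 0 (C - 1/3) * real k ^ card (verts (cone w G))"
proof -
  let ?N = "card (verts G)"
  \<comment> \<open>The constant obtained at a given \<open>m\<close>. Its last factor accounts for
    passing from \<open>m ^ (r + 1)\<close> to \<open>Suc m ^ (r + 1)\<close>, and its limit is
    \<open>C - 1/2\<close>.\<close>
  define Z where "Z m = (C - real m / (2 * real (Suc m))) * (real (Suc m) / real m) ^ (r + 1)" for m
  have "finite (verts G)" using G by (simp add: hypergraph_def)
  then have NC: "card (verts (cone w G)) = Suc ?N" using G(2) by (simp add: cone_def)
  have "(\<lambda>m. (C - real m / real (Suc m) * (1/2)) * (real (Suc m) / real m) ^ (r + 1))
      \<longlonglongrightarrow> (C - 1 * (1/2)) * 1 ^ (r + 1)"
    by (intro tendsto_intros LIMSEQ_n_over_Suc_n LIMSEQ_Suc_n_over_n)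
  then have "Z \<longlonglongrightarrow> C - 1/2" unfolding Z_def by (simp add: field_simps)
  then have evZ: "\<forall>\<^sub>F m in sequentially. Z m < C - 1/3"
    by (rule order_tendstoD(2)) simp
  have "\<forall>\<^sub>F m in sequentially.
    (real (chromatic_poly (cone w G) (Suc m)) - real (DP_color_fun (cone w G) (Suc m))) * real (Suc m) ^ (r + 1)
      \<le> max 0 (C - 1/3) * real (Suc m) ^ Suc ?N"
    \<comment> \<open>The threshold on \<open>m\<close> makes the error term with
      \<open>card (edges G)\<close> at most half of the main term, and ensures that \<open>m\<close>
      is positive.\<close>
    using ev evZ eventually_ge_at_top[of "2 * card (edges G) + 1"]
  proof eventually_elim
    case (elim m)
    let ?D = "real (chromatic_poly G m) - real (DP_color_fun G m)"
    let ?D' = "real (chromatic_poly (cone w G) (Suc m)) - real (DP_color_fun (cone w G) (Suc m))"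
    have m: "m \<ge> 1" and mE: "2 * real (card (edges G)) \<le> real m" using elim(3) by auto
    \<comment> \<open>A positive deficit rules out the first alternative of
      \<open>DP_color_fun_cone\<close>, so the surplus is available.\<close>
    show ?case
    proof (cases "?D' \<le> 0")
      case True
      then have "?D' * real (Suc m) ^ (r + 1) \<le> 0" by (intro mult_nonpos_nonneg) auto
      also have "0 \<le> max 0 (C - 1/3) * real (Suc m) ^ Suc ?N" by (intro mult_nonneg_nonneg) auto
      finally show ?thesis .
    next
      case False
      then obtain X where X: "Suc m * DP_color_fun G m + X \<le> DP_color_fun (cone w G) (Suc m)"
        "m ^ (?N + 1) \<le> X * m ^ (r + 1) + card (edges G) * m ^ ?N"
        using DP_color_fun_cone[OF G anti r m] by fastforce
      have "real (Suc m * DP_color_fun G m + X) \<le> real (DP_color_fun (cone w G) (Suc m))"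
        using X(1) by (simp only: of_nat_le_iff)
      moreover have "real (chromatic_poly (cone w G) (Suc m)) \<le> real (Suc m * chromatic_poly G m)"
        using chromatic_poly_cone_le[OF G] by (simp only: of_nat_le_iff)
      ultimately have D': "?D' \<le> real (Suc m) * ?D - real X"
        by (simp only: of_nat_add of_nat_mult right_diff_distrib)
      have "real (m ^ (?N + 1)) \<le> real (X * m ^ (r + 1) + card (edges G) * m ^ ?N)"
        using X(2) by (simp only: of_nat_le_iff)
      then have "real m ^ (?N + 1) \<le> real X * real m ^ (r + 1) + real (card (edges G)) * real m ^ ?N"
        by simp
      moreover have "real (card (edges G)) * real m ^ ?N \<le> real m / 2 * real m ^ ?N"
        using mE by (intro mult_right_mono) auto
      ultimately have gain: "real m * real m ^ ?N / 2 \<le> real X * real m ^ (r + 1)"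
        by simp
      have "?D' * real m ^ (r + 1) \<le> (real (Suc m) * ?D - real X) * real m ^ (r + 1)"
        using D' by (intro mult_right_mono) auto
      also have "\<dots> = real (Suc m) * (?D * real m ^ (r + 1)) - real X * real m ^ (r + 1)"
        by (simp only: left_diff_distrib mult.assoc)
      also have "\<dots> \<le> real (Suc m) * (C * real m ^ ?N) - real m * real m ^ ?N / 2"
        using elim(1) gain by (intro diff_mono mult_left_mono) auto
      also have "\<dots> = real m ^ ?N * real (Suc m) * (C - real m / (2 * real (Suc m)))"
        by (simp add: field_simps)
      finally have *: "?D' * real m ^ (r + 1) \<le> real m ^ ?N * real (Suc m) * (C - real m / (2 * real (Suc m)))" .
      have "?D' * real (Suc m) ^ (r + 1) = ?D' * real m ^ (r + 1) * (real (Suc m) / real m) ^ (r + 1)"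
        using m by (simp only: power_divide) simp
      also have "\<dots> \<le> real m ^ ?N * real (Suc m) * (C - real m / (2 * real (Suc m))) * (real (Suc m) / real m) ^ (r + 1)"
        by (intro mult_right_mono *) simp
      also have "\<dots> = real m ^ ?N * real (Suc m) * Z m" by (simp only: Z_def mult.assoc)
      \<comment> \<open>Replacing \<open>Z m\<close> by a nonnegative constant allows
        \<open>m\<close> to be raised to \<open>Suc m\<close> in the remaining power.\<close>
      also have "\<dots> \<le> real m ^ ?N * real (Suc m) * max 0 (C - 1/3)"
        using elim(2) by (intro mult_left_mono) auto
      also have "\<dots> \<le> real (Suc m) ^ ?N * real (Suc m) * max 0 (C - 1/3)"
        by (intro mult_right_mono power_mono) auto
      also have "\<dots> = max 0 (C - 1/3) * real (Suc m) ^ Suc ?N" by (simp add: mult_ac)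
      finally show ?thesis .
    qed
  qed
  then show ?thesis unfolding NC by (rule eventually_sequentially_Suc[THEN iffD1])
qed

section \<open>Joins with complete graphs as iterated cones, and the conclusion\<close>

text \<open>The new vertex is adjacent to all earlier ones and to all of \<open>H\<close>. Both
  sides live on the same sum type, so this is an equality and the iteration involves no
  isomorphisms.\<close>

lemma join_complete_graph_Suc:
  "join (complete_graph (Suc p)) H = cone (Inl (Suc p)) (join (complete_graph p) H)"
proof -
  have iv: "{1..Suc p} = insert (Suc p) {1..p}" by auto
  have "{e. e \<subseteq> {1..Suc p} \<and> card e = 2} = {e. e \<subseteq> {1..p} \<and> card e = 2} \<union> (\<lambda>i. {Suc p, i}) ` {1..p}"
    (is "?A = ?B \<union> ?C")
  proof (intro equalityI subsetI)
    fix e assume e: "e \<in> ?A"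
    show "e \<in> ?B \<union> ?C"
    proof (cases "Suc p \<in> e")
      case True
      with e obtain j where "e = {Suc p, j}" "j \<noteq> Suc p" unfolding card_2_iff by blast
      with e show ?thesis by auto
    next
      case False
      with e show ?thesis unfolding iv by blast
    qed
  next
    fix e assume e: "e \<in> ?B \<union> ?C"
    have "card {Suc p, i} = 2" if "i \<in> {1..p}" for i using that by (simp add: card_insert_if)
    with e show "e \<in> ?A" unfolding iv by auto
  qed
  then have E: "edges (complete_graph (Suc p)) = edges (complete_graph p) \<union> (\<lambda>i. {Suc p, i}) ` {1..p}"
    by (simp add: complete_graph_def)
  have V: "verts (complete_graph (Suc p)) = insert (Suc p) (verts (complete_graph p))"
    "verts (complete_graph p) = {1..p}"
    by (auto simp: complete_graph_def)
  have "edges (join (complete_graph (Suc p)) H) = edges (cone (Inl (Suc p)) (join (complete_graph p) H))"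
    unfolding join_def cone_def hypergraph.simps E V by (auto simp: image_Un image_image)
  moreover have "verts (join (complete_graph (Suc p)) H) = verts (cone (Inl (Suc p)) (join (complete_graph p) H))"
    unfolding join_def cone_def hypergraph.simps V by auto
  ultimately show ?thesis by simp
qed

text \<open>\<open>complete_graph 0\<close> has no vertices, so the join is a copy of
  \<open>H\<close> on the sum type. This lemma and its counterpart for \<open>DP_color_fun\<close>
  carry the bound on the deficit of \<open>H\<close> to that copy.\<close>

lemma chromatic_poly_empty_join_le:
  fixes H :: "'a hypergraph"
  assumes H: "hypergraph H"
  shows "chromatic_poly (join (complete_graph 0) H) k \<le> chromatic_poly H k"
  unfolding chromatic_poly_def
proof (rule card_inj_on_le)
  let ?J = "join (complete_graph 0) H" and ?h = "\<lambda>f :: nat + 'a \<Rightarrow> nat. f \<circ> Inr"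
  have V: "verts ?J = Inr ` verts H" and E: "edges ?J = (\<lambda>e. Inr ` e) ` edges H"
    by (auto simp: join_def complete_graph_def)
  show "inj_on ?h (proper_colorings ?J k)"
  proof (rule inj_onI)
    fix f g assume "f \<in> proper_colorings ?J k" "g \<in> proper_colorings ?J k" and eq: "?h f = ?h g"
    then have fg: "f \<in> verts ?J \<rightarrow>\<^sub>E {1..k}" "g \<in> verts ?J \<rightarrow>\<^sub>E {1..k}"
      unfolding proper_colorings_def by simp_all
    show "f = g" by (rule PiE_ext[OF fg]) (use fun_cong[OF eq] V in auto)
  qed
  show "?h ` proper_colorings ?J k \<subseteq> proper_colorings H k"
  proof (rule image_subsetI)
    fix f assume f: "f \<in> proper_colorings ?J k"
    then have "f \<circ> Inr \<in> verts H \<rightarrow>\<^sub>E {1..k}"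
      unfolding proper_colorings_def V by (auto simp: PiE_iff extensional_def)
    moreover have "\<forall>e\<in>edges H. \<not> (\<exists>c. \<forall>v\<in>e. (f \<circ> Inr) v = c)"
      using f unfolding proper_colorings_def E by simp
    ultimately show "?h f \<in> proper_colorings H k" unfolding proper_colorings_def by blast
  qed
  have "finite (verts H \<rightarrow>\<^sub>E {1..k})" using H by (intro finite_PiE) (auto simp: hypergraph_def)
  then show "finite (proper_colorings H k)" unfolding proper_colorings_def by simp
qed

text \<open>Composition with \<open>Inr\<close> carries a cover of the copy back to a cover of
  \<open>H\<close>, whose colorings embed into those of the copy.\<close>

lemma DP_color_fun_le_empty_join:
  fixes H :: "'a hypergraph"
  assumes H: "hypergraph H" and J: "hypergraph (join (complete_graph 0) H)"
  shows "DP_color_fun H k \<le> DP_color_fun (join (complete_graph 0) H) k"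
proof -
  let ?J = "join (complete_graph 0) H"
  have V: "verts ?J = Inr ` verts H" and E: "edges ?J = (\<lambda>e. Inr ` e) ` edges H"
    by (auto simp: join_def complete_graph_def)
  obtain F where F: "fold_cover ?J k F"
    and DP: "DP_color_fun ?J k = card (list_colorings ?J (\<lambda>_. {1..k}) F)"
    using DP_color_fun_attained[OF J] by blast
  have sep: "separated F" and ran: "\<And>\<phi>. \<phi> \<in> F \<Longrightarrow> ran \<phi> \<subseteq> {1..k}"
    and domE: "\<And>\<phi>. \<phi> \<in> F \<Longrightarrow> dom \<phi> \<in> edges ?J"
    using F unfolding fold_cover_iff[OF J] list_cover_def by blast+
  have dom: "dom (\<phi> \<circ> Inr) \<in> edges H \<and> dom \<phi> = Inr ` dom (\<phi> \<circ> Inr)" if \<phi>: "\<phi> \<in> F" for \<phi>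
  proof -
    obtain e where e: "e \<in> edges H" "dom \<phi> = Inr ` e" using domE[OF \<phi>] E by auto
    then have "dom (\<phi> \<circ> Inr) = e" by (auto simp: set_eq_iff dom_def)
    with e show ?thesis by simp
  qed
  let ?F = "(\<lambda>\<phi>. \<phi> \<circ> Inr) ` F"
  have "fold_cover H k ?F"
    unfolding fold_cover_iff[OF H] list_cover_def
  proof (intro conjI ballI)
    fix \<phi>' assume "\<phi>' \<in> ?F"
    then obtain \<phi> where \<phi>: "\<phi> \<in> F" "\<phi>' = \<phi> \<circ> Inr" by blast
    show "dom \<phi>' \<in> edges H" using dom[OF \<phi>(1)] \<phi>(2) by simp
    have "ran \<phi>' \<subseteq> ran \<phi>" unfolding \<phi>(2) ran_def by auto
    then show "ran \<phi>' \<subseteq> {1..k}" using ran[OF \<phi>(1)] by (rule subset_trans)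
  next
    show "separated ?F"
      unfolding separated_def
    proof (intro ballI allI impI)
      fix \<phi>' \<psi>' v x
      assume *: "\<phi>' \<in> ?F" "\<psi>' \<in> ?F" "dom \<phi>' = dom \<psi>' \<and> \<phi>' v = Some x \<and> \<psi>' v = Some x"
      then obtain \<phi> \<psi> where \<phi>: "\<phi> \<in> F" "\<phi>' = \<phi> \<circ> Inr" and \<psi>: "\<psi> \<in> F" "\<psi>' = \<psi> \<circ> Inr" by blast
      have "dom \<phi> = dom \<psi>" using dom[OF \<phi>(1)] dom[OF \<psi>(1)] * \<phi>(2) \<psi>(2) by simp
      then have "\<phi> = \<psi>"
        by (rule separatedD[OF sep \<phi>(1) \<psi>(1), of "Inr v" x]) (use * \<phi> \<psi> in simp_all)
      then show "\<phi>' = \<psi>'" using \<phi> \<psi> by simp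
    qed
  qed
  then have "DP_color_fun H k \<le> card (list_colorings H (\<lambda>_. {1..k}) ?F)"
    by (rule DP_color_fun_le[OF H])
  also have "\<dots> \<le> card (list_colorings ?J (\<lambda>_. {1..k}) F)"
  proof (rule card_inj_on_le)
    \<comment> \<open>The value \<open>undefined\<close> on the left summand keeps the function
      extensional on the vertices of the copy.\<close>
    let ?h = "\<lambda>f u. case u of Inl a \<Rightarrow> undefined | Inr v \<Rightarrow> f v"
    show "inj_on ?h (list_colorings H (\<lambda>_. {1..k}) ?F)"
    proof (rule inj_onI)
      fix f g :: "'a \<Rightarrow> nat" assume eq: "?h f = ?h g"
      show "f = g" using fun_cong[OF eq, of "Inr _"] by auto
    qed
    show "?h ` list_colorings H (\<lambda>_. {1..k}) ?F \<subseteq> list_colorings ?J (\<lambda>_. {1..k}) F"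
    proof (rule image_subsetI)
      fix f assume f: "f \<in> list_colorings H (\<lambda>_. {1..k}) ?F"
      then have "?h f \<in> verts ?J \<rightarrow>\<^sub>E {1..k}"
        unfolding list_colorings_def V by (auto simp: PiE_iff extensional_def split: sum.split)
      moreover have "\<exists>v x. \<phi> v = Some x \<and> ?h f v \<noteq> x" if \<phi>: "\<phi> \<in> F" for \<phi>
      proof -
        have "\<exists>v x. (\<phi> \<circ> Inr) v = Some x \<and> f v \<noteq> x"
          using f \<phi> unfolding list_colorings_def by simp
        then obtain v x where "\<phi> (Inr v) = Some x" "f v \<noteq> x" by auto
        then show ?thesis by (intro exI[of _ "Inr v"] exI[of _ x]) simp
      qed
      ultimately show "?h f \<in> list_colorings ?J (\<lambda>_. {1..k}) F" unfolding list_colorings_def by blast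
    qed
    show "finite (list_colorings ?J (\<lambda>_. {1..k}) F)"
      by (rule finite_list_colorings) (use J in \<open>auto simp: hypergraph_def\<close>)
  qed
  finally show ?thesis using DP by simp
qed

text \<open>Induction on \<open>p\<close>, carrying along what \<open>cone_deficit\<close> requires
  of its base. Starting at \<open>p = 0\<close> makes the base case a copy of \<open>H\<close>, and
  each new vertex lowers the constant by 1/3.\<close>

lemma join_complete_graph_deficit:
  fixes H :: "'a hypergraph" and C :: real
  assumes H: "hypergraph H" "uniform r H" and r: "r \<ge> 2" and C: "C \<ge> 0"
    and ev: "\<forall>\<^sub>F k in sequentially.
      (real (chromatic_poly H k) - real (DP_color_fun H k)) * real k ^ (r + 1) \<le> C * real k ^ card (verts H)"
  defines "J \<equiv> \<lambda>p. join (complete_graph p) H"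
  shows "hypergraph (J p) \<and> antichain (J p) \<and> (\<forall>e\<in>edges (J p). card e \<le> r) \<and>
    (\<forall>\<^sub>F k in sequentially.
      (real (chromatic_poly (J p) k) - real (DP_color_fun (J p) k)) * real k ^ (r + 1)
        \<le> max 0 (C - real p / 3) * real k ^ card (verts (J p)))"
proof (induction p)
  case 0
  have V: "verts (J 0) = Inr ` verts H" and E: "edges (J 0) = (\<lambda>e. Inr ` e) ` edges H"
    by (auto simp: J_def join_def complete_graph_def)
  have card: "card e = r" if "e \<in> edges (J 0)" for e
    using that H(2) E by (auto simp: uniform_def card_image)
  have hyp: "hypergraph (J 0)"
    using H(1) unfolding hypergraph_def V E by (auto simp: card_image)
  \<comment> \<open>Uniformity enters here: finite edges of equal size are comparable only if they
    are equal.\<close>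
  moreover have "antichain (J 0)"
    unfolding antichain_def
  proof (intro ballI impI)
    fix e e' assume e: "e \<in> edges (J 0)" "e' \<in> edges (J 0)" "e \<subseteq> e'"
    have "finite e'" using card[OF e(2)] r by (intro card_ge_0_finite) simp
    then show "e = e'" using card[OF e(1)] card[OF e(2)] e(3) by (simp add: card_subset_eq)
  qed
  moreover have "\<forall>\<^sub>F k in sequentially.
      (real (chromatic_poly (J 0) k) - real (DP_color_fun (J 0) k)) * real k ^ (r + 1)
        \<le> max 0 (C - real 0 / 3) * real k ^ card (verts (J 0))"
    using ev
  proof eventually_elim
    case (elim k)
    have "real (chromatic_poly (J 0) k) - real (DP_color_fun (J 0) k)
        \<le> real (chromatic_poly H k) - real (DP_color_fun H k)"
      using chromatic_poly_empty_join_le[OF H(1), of k] DP_color_fun_le_empty_join[OF H(1) hyp[unfolded J_def], of k]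
      unfolding J_def by simp
    then have "(real (chromatic_poly (J 0) k) - real (DP_color_fun (J 0) k)) * real k ^ (r + 1)
        \<le> (real (chromatic_poly H k) - real (DP_color_fun H k)) * real k ^ (r + 1)"
      by (rule mult_right_mono) simp
    also note elim
    finally show ?case using C V by (simp add: card_image)
  qed
  ultimately show ?case using card by simp
next
  case (Suc p)
  let ?w = "Inl (Suc p) :: nat + 'a"
  have J: "J (Suc p) = cone ?w (J p)" unfolding J_def by (rule join_complete_graph_Suc)
  have w: "?w \<notin> verts (J p)" by (auto simp: J_def join_def complete_graph_def)
  have IH: "hypergraph (J p)" "antichain (J p)" "\<And>e. e \<in> edges (J p) \<Longrightarrow> card e \<le> r"
    "\<forall>\<^sub>F k in sequentially.
      (real (chromatic_poly (J p) k) - real (DP_color_fun (J p) k)) * real k ^ (r + 1)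
        \<le> max 0 (C - real p / 3) * real k ^ card (verts (J p))"
    using Suc.IH by blast+
  have "max 0 (max 0 (C - real p / 3) - 1/3) = max 0 (C - real (Suc p) / 3)"
    by (simp add: max_def field_simps)
  then have "\<forall>\<^sub>F k in sequentially.
      (real (chromatic_poly (J (Suc p)) k) - real (DP_color_fun (J (Suc p)) k)) * real k ^ (r + 1)
        \<le> max 0 (C - real (Suc p) / 3) * real k ^ card (verts (J (Suc p)))"
    using cone_deficit[OF IH(1) w IH(2,3,4)] unfolding J by simp
  moreover have "card e \<le> r" if "e \<in> edges (J (Suc p))" for e
  proof -
    \<comment> \<open>The hypothesis \<open>r \<ge> 2\<close> keeps the apex edges within the size
      bound.\<close>
    have "card {?w, v} \<le> 2" for v by (simp add: card_insert_if)
    then show ?thesis using that IH(3) r unfolding J cone_def by (auto intro: order_trans)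
  qed
  ultimately show ?case
    using hypergraph_cone[OF IH(1) w] antichain_cone[OF IH(1) w IH(2)] unfolding J by blast
qed

theorem theorem14:
  fixes H :: "'a hypergraph" and r n :: nat
  assumes "r \<ge> 2"
    and "hypergraph H"
    and "uniform r H"
    and "card (verts H) = n"
    and "(\<lambda>k::nat. real (chromatic_poly H k) - real (DP_color_fun H k))
           \<in> O(\<lambda>k. real k powi (int n - int r - 1))"
  shows "\<exists>p\<ge>1. \<exists>N\<ge>1. \<forall>k\<ge>N.
           DP_color_fun (join (complete_graph p) H) k = chromatic_poly (join (complete_graph p) H) k"
proof -
  obtain C :: real where C: "C > 0" and
    bound: "\<forall>\<^sub>F k in sequentially. norm (real (chromatic_poly H k) - real (DP_color_fun H k))
      \<le> C * norm (real k powi (int n - int r - 1))"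
    using landau_o.bigE[OF assms(5)] by blast
  have ev: "\<forall>\<^sub>F k in sequentially.
      (real (chromatic_poly H k) - real (DP_color_fun H k)) * real k ^ (r + 1) \<le> C * real k ^ card (verts H)"
    using bound eventually_ge_at_top[of 1]
  proof eventually_elim
    case (elim k)
    \<comment> \<open>Exponents add because \<open>k\<close> is nonzero; the product clears the
      possibly negative exponent \<open>n - r - 1\<close>.\<close>
    have "real k powi (int n - int r - 1) * real k ^ (r + 1) = real k powi (int n - int r - 1 + int (r + 1))"
      using elim(2) by (subst power_int_add) (auto simp: power_int_add)
    also have "int n - int r - 1 + int (r + 1) = int n" by simp
    finally have *: "real k powi (int n - int r - 1) * real k ^ (r + 1) = real k ^ n" by simp
    have "(real (chromatic_poly H k) - real (DP_color_fun H k)) * real k ^ (r + 1)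
        \<le> (C * real k powi (int n - int r - 1)) * real k ^ (r + 1)"
      using elim(1) by (intro mult_right_mono) auto
    also have "\<dots> = C * real k ^ card (verts H)" using * assms(4) by (simp only: mult.assoc)
    finally show ?case .
  qed
  \<comment> \<open>At a loss of 1/3 per vertex, more than \<open>3 * C\<close> vertices bring the
    constant to 0. The deficit is then eventually nonpositive, and the reverse inequality holds for
    every \<open>k\<close>.\<close>
  obtain p :: nat where p: "3 * C < real p" using reals_Archimedean2 by blast
  let ?J = "join (complete_graph p) H"
  have p0: "max 0 (C - real p / 3) = 0" using p by simp
  have J: "hypergraph ?J" and D: "\<forall>\<^sub>F k in sequentially.
      (real (chromatic_poly ?J k) - real (DP_color_fun ?J k)) * real k ^ (r + 1) \<le> 0"
    using join_complete_graph_deficit[OF assms(2,3,1) less_imp_le[OF C] ev, of p] p0 by simp_all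
  have "\<forall>\<^sub>F k in sequentially. DP_color_fun ?J k = chromatic_poly ?J k"
    using D eventually_ge_at_top[of 1]
  proof eventually_elim
    case (elim k)
    have "real k ^ (r + 1) > 0" using elim(2) by (intro zero_less_power) simp
    then have "real (chromatic_poly ?J k) - real (DP_color_fun ?J k) \<le> 0"
      using elim(1) by (metis mult_pos_pos not_le)
    then show ?case using DP_color_fun_le_chromatic_poly[OF J, of k] by simp
  qed
  then obtain N where N: "\<And>k. k \<ge> N \<Longrightarrow> DP_color_fun ?J k = chromatic_poly ?J k"
    unfolding eventually_sequentially by blast
  have "p \<ge> 1" using p C by (cases p) auto
  moreover have "\<forall>k\<ge>max 1 N. DP_color_fun ?J k = chromatic_poly ?J k" using N by simp
  ultimately show ?thesis by (intro exI[of _ p] conjI exI[of _ "max 1 N"]) auto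
qed

end
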